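(* Let $\mathbb{F}$ be a field. Let $B_1$ be the Blaschke product with two zero points $\beta_0,\beta_1\in\mathbb{D}$ and let $B_2$ be the Blaschke product with two zero points $\gamma_0,\gamma_1\in\mathbb{D}$ (zeros counted with multiplicity, so $\beta_0=\beta_1$ or $\gamma_0=\gamma_1$ is allowed and means a zero of order two). Let $\mathbb{B}_1,\mathbb{B}_2$ be the persistence modules induced by $B_1,B_2$. Then $$d_{int}(\mathbb{B}_1,\mathbb{B}_2)=\min\left(\max\left(\tfrac12\ln\tfrac{1}{\sqrt{1-|w_2|^2}},\ \tfrac12\ln\tfrac{1}{\sqrt{1-|w_1|^2}}\right),\ \left|\ln\tfrac{\sqrt{1-|w_1|^2}}{\sqrt{1-|w_2|^2}}\right|\right),$$ where $w_1=\frac{\beta_0-\beta_1}{1-\overline{\beta_0}\beta_1}$ and $w_2=\frac{\gamma_0-\gamma_1}{1-\overline{\gamma_0}\gamma_1}$.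
   Context: $\mathbb{D}$ is the open unit disk. The Blaschke product with zeros $\beta_0,\beta_1$ is $\prod_{i=0}^{1}\frac{\beta_i-z}{1-\overline{\beta_i}z}$ up to a unimodular constant (only $|B|$ matters). Persistence module (over $\mathbb{F}$): vector spaces $\{V_t\}_{t\in\mathbb{R}}$ with linear maps $\pi_{s,t}:V_s\to V_t$ ($s\le t$) satisfying $\pi_{s,r}=\pi_{t,r}\circ\pi_{s,t}$, $\pi_{t,t}=\mathrm{id}$, and $V_s=0$ for all sufficiently small $s$. Morphisms are families of linear maps commuting with the structure maps. The shift $\mathbb{V}[\Delta]$ has $(V[\Delta])_t=V_{t+\Delta}$, $(\pi[\Delta])_{s,t}=\pi_{s+\Delta,t+\Delta}$; for $\Delta>0$, $\Phi^{\Delta}_{\mathbb{V}}:\mathbb{V}\to\mathbb{V}[\Delta]$ is given by $\pi_{t,t+\Delta}$. $\mathbb{V},\mathbb{W}$ are $\Delta$-interleaved if there are morphisms $F:\mathbb{V}\to\mathbb{W}[\Delta]$, $G:\mathbb{W}\to\mathbb{V}[\Delta]$ with $G[\Delta]\circ F=\Phi^{2\Delta}_{\mathbb{V}}$ and $F[\Delta]\circ G=\Phi^{2\Delta}_{\mathbb{W}}$; $d_{int}(\mathbb{V},\mathbb{W})=\inf\{\Delta>0:\mathbb{V},\mathbb{W}\text{ are }\Delta\text{-interleaved}\}$. Persistence module induced by an inner function $u$ (bounded analytic on $\mathbb{D}$ with a.e. unimodular radial boundary limits; e.g. a Blaschke product): for $t>0$ let $\theta(t)=\frac{e^t-1}{e^t+1}$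 and $\Sigma_{u,t}=\{z\in\mathbb{D}:|u(z)|<\theta(t)\}$; $V_t=H_0(\Sigma_{u,t};\mathbb{F})$ for $t>0$ (all higher homology vanishes), $V_t=0$ for $t\le0$, and $\pi_{s,t}$ is induced by the inclusion $\Sigma_{u,s}\hookrightarrow\Sigma_{u,t}$ for $0<s\le t$. *)

theory Defs
  imports
    "HOL-Homology.Homology"
    "HOL-Algebra.Algebraic_Closure_Type"
    "HOL-Library.Extended_Real"
begin

no_notation Polynomials.var (\<open>X\<index>\<close>) (* frees the identifier X *)

section \<open>Persistence modules and the interleaving distance\<close>

text \<open>
  The ground field is a type of class \<^class>\<open>field\<close>. Vector spaces over it are modules in the
  sense of \<^locale>\<open>Module.module\<close>, over the ring \<^const>\<open>ring_of_type_algebra\<close> with carrier \<^term>\<open>UNIV\<close>;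
  of their records only the carrier, zero, addition and scalar multiplication matter.
  All spaces of one persistence module live in a common type, each with its own carrier.
\<close>

record ('f, 'v) pmodule =
  space :: "real \<Rightarrow> ('f, 'v) module"
  smap :: "real \<Rightarrow> real \<Rightarrow> 'v \<Rightarrow> 'v"

definition linear_on :: "('f, 'v) module \<Rightarrow> ('f, 'w) module \<Rightarrow> ('v \<Rightarrow> 'w) \<Rightarrow> bool" where
  "linear_on V W f \<longleftrightarrow>
     f \<in> carrier V \<rightarrow> carrier W \<and>
     (\<forall>x\<in>carrier V. \<forall>y\<in>carrier V. f (x \<oplus>\<^bsub>V\<^esub> y) = f x \<oplus>\<^bsub>W\<^esub> f y) \<and>
     (\<forall>a. \<forall>x\<in>carrier V. f (a \<odot>\<^bsub>V\<^esub> x) = a \<odot>\<^bsub>W\<^esub> f x)"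

definition persistence_module :: "('f::field, 'v) pmodule \<Rightarrow> bool" where
  "persistence_module V \<longleftrightarrow>
     (\<forall>t. Module.module (ring_of_type_algebra :: 'f ring) (space V t)) \<and>
     (\<forall>s t. s \<le> t \<longrightarrow> linear_on (space V s) (space V t) (smap V s t)) \<and>
     (\<forall>s t r. s \<le> t \<longrightarrow> t \<le> r \<longrightarrow>
        (\<forall>x\<in>carrier (space V s). smap V s r x = smap V t r (smap V s t x))) \<and>
     (\<forall>t. \<forall>x\<in>carrier (space V t). smap V t t x = x) \<and>
     (\<exists>s0. \<forall>s<s0. carrier (space V s) = {\<zero>\<^bsub>space V s\<^esub>})"

definition pm_morphism ::
    "('f, 'v) pmodule \<Rightarrow> ('f, 'w) pmodule \<Rightarrow> (real \<Rightarrow> 'v \<Rightarrow> 'w) \<Rightarrow> bool" where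
  "pm_morphism V W F \<longleftrightarrow>
     (\<forall>t. linear_on (space V t) (space W t) (F t)) \<and>
     (\<forall>s t. s \<le> t \<longrightarrow>
        (\<forall>x\<in>carrier (space V s). F t (smap V s t x) = smap W s t (F s x)))"

definition shift :: "real \<Rightarrow> ('f, 'v) pmodule \<Rightarrow> ('f, 'v) pmodule" where
  "shift \<Delta> V = \<lparr>space = (\<lambda>t. space V (t + \<Delta>)), smap = (\<lambda>s t. smap V (s + \<Delta>) (t + \<Delta>))\<rparr>"

definition shift_morphism :: "real \<Rightarrow> (real \<Rightarrow> 'v \<Rightarrow> 'w) \<Rightarrow> (real \<Rightarrow> 'v \<Rightarrow> 'w)" where
  "shift_morphism \<Delta> F = (\<lambda>t. F (t + \<Delta>))"

definition shift_transition :: "real \<Rightarrow> ('f, 'v) pmodule \<Rightarrow> (real \<Rightarrow> 'v \<Rightarrow> 'v)" where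
  "shift_transition \<Delta> V = (\<lambda>t. smap V t (t + \<Delta>))"

definition interleaved :: "real \<Rightarrow> ('f, 'v) pmodule \<Rightarrow> ('f, 'w) pmodule \<Rightarrow> bool" where
  "interleaved \<Delta> V W \<longleftrightarrow>
     (\<exists>F G. pm_morphism V (shift \<Delta> W) F \<and> pm_morphism W (shift \<Delta> V) G \<and>
        (\<forall>t. \<forall>x\<in>carrier (space V t).
           shift_morphism \<Delta> G t (F t x) = shift_transition (2 * \<Delta>) V t x) \<and>
        (\<forall>t. \<forall>y\<in>carrier (space W t).
           shift_morphism \<Delta> F t (G t y) = shift_transition (2 * \<Delta>) W t y))"

text \<open>Extended real valued, so that modules without any interleaving are at distance \<open>\<infinity>\<close>.\<close>

definition interleaving_distance :: "('f, 'v) pmodule \<Rightarrow> ('f, 'w) pmodule \<Rightarrow> ereal" where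
  "interleaving_distance V W = Inf {ereal \<Delta> |\<Delta>. \<Delta> > 0 \<and> interleaved \<Delta> V W}"


section \<open>Singular homology with coefficients in a field\<close>

text \<open>
  The library provides singular homology with integer coefficients only. The definitions
  below replace the integers by a field and otherwise follow \<^const>\<open>singular_chain\<close> and
  \<^const>\<open>chain_boundary\<close>.
\<close>

type_synonym ('a, 'f) fchain = "((nat \<Rightarrow> real) \<Rightarrow> 'a) \<Rightarrow>\<^sub>0 'f"

definition fchains :: "nat \<Rightarrow> 'a topology \<Rightarrow> ('a, 'f::field) fchain set" where
  "fchains p X = {c. Poly_Mapping.keys c \<subseteq> singular_simplex_set p X}"

definition fscale :: "'f \<Rightarrow> ('b \<Rightarrow>\<^sub>0 'f) \<Rightarrow> ('b \<Rightarrow>\<^sub>0 'f::field)" where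
  "fscale a c = Poly_Mapping.map (\<lambda>x. a * x) c"

definition fboundary :: "nat \<Rightarrow> ('a, 'f::field) fchain \<Rightarrow> ('a, 'f) fchain" where
  "fboundary p c =
     (if p = 0 then 0
      else \<Sum>\<sigma>\<in>Poly_Mapping.keys c. \<Sum>k\<le>p.
             Poly_Mapping.single (singular_face p k \<sigma>) ((-1) ^ k * Poly_Mapping.lookup c \<sigma>))"

definition fcycles :: "nat \<Rightarrow> 'a topology \<Rightarrow> ('a, 'f::field) fchain set" where
  "fcycles p X = {c \<in> fchains p X. fboundary p c = 0}"

definition fboundaries :: "nat \<Rightarrow> 'a topology \<Rightarrow> ('a, 'f::field) fchain set" where
  "fboundaries p X = fboundary (Suc p) ` fchains (Suc p) X"

text \<open>
  The quotient of a subspace \<open>Z\<close> by a subspace \<open>B\<close>, realised by cosets. Adding \<open>B\<close> in the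
  scalar multiplication makes \<open>0 \<odot> X\<close> the zero coset \<open>B\<close> rather than \<open>{0}\<close>.
\<close>

definition quotient_space ::
    "('b \<Rightarrow>\<^sub>0 'f::field) set \<Rightarrow> ('b \<Rightarrow>\<^sub>0 'f) set \<Rightarrow> ('f, ('b \<Rightarrow>\<^sub>0 'f) set) module" where
  "quotient_space Z B =
     \<lparr>carrier = (\<lambda>z. (+) z ` B) ` Z,
      monoid.mult = undefined, monoid.one = undefined,
      ring.zero = B,
      ring.add = (\<lambda>X Y. {x + y |x y. x \<in> X \<and> y \<in> Y}),
      module.smult = (\<lambda>a X. {fscale a x + b |x b. x \<in> X \<and> b \<in> B})\<rparr>"

definition homology_space ::
    "nat \<Rightarrow> 'a topology \<Rightarrow> ('f::field, ('a, 'f) fchain set) module" where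
  "homology_space p X = quotient_space (fcycles p X) (fboundaries p X)"

text \<open>
  The map induced in homology by the inclusion of a subspace into \<open>Y\<close>, sending the class of a
  cycle to its class in \<open>Y\<close>. Singular simplices of a subspace are literally singular simplices of
  \<open>Y\<close>, so no chain map has to be applied.
\<close>

definition homology_inclusion ::
    "nat \<Rightarrow> 'a topology \<Rightarrow> ('a, 'f::field) fchain set \<Rightarrow> ('a, 'f) fchain set" where
  "homology_inclusion p Y X = {x + b |x b. x \<in> X \<and> b \<in> fboundaries p Y}"


section \<open>The persistence module induced by a function on the unit disk\<close>

definition theta :: "real \<Rightarrow> real" where
  "theta t = (exp t - 1) / (exp t + 1)"

definition sublevel :: "(complex \<Rightarrow> complex) \<Rightarrow> real \<Rightarrow> complex set" where
  "sublevel u t = {z \<in> ball 0 1. norm (u z) < theta t}"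

definition zero_space :: "'v \<Rightarrow> ('f, 'v) module" where
  "zero_space z =
     \<lparr>carrier = {z}, monoid.mult = undefined, monoid.one = undefined,
      ring.zero = z, ring.add = (\<lambda>_ _. z), module.smult = (\<lambda>_ _. z)\<rparr>"

definition induced_space ::
    "(complex \<Rightarrow> complex) \<Rightarrow> real \<Rightarrow> ('f::field, (complex, 'f) fchain set) module" where
  "induced_space u t =
     (if t > 0 then homology_space 0 (top_of_set (sublevel u t)) else zero_space {0})"

definition induced_pmodule ::
    "(complex \<Rightarrow> complex) \<Rightarrow> ('f::field, (complex, 'f) fchain set) pmodule" where
  "induced_pmodule u =
     \<lparr>space = induced_space u,
      smap = (\<lambda>s t X. if s > 0 then homology_inclusion 0 (top_of_set (sublevel u t)) X
                      else \<zero>\<^bsub>induced_space u t\<^esub>)\<rparr>"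

text \<open>
  The list enumerates the zeros with multiplicity; only the values on the unit disk matter.
\<close>

definition blaschke_product :: "complex list \<Rightarrow> (complex \<Rightarrow> complex) \<Rightarrow> bool" where
  "blaschke_product zs B \<longleftrightarrow>
     (\<exists>c. norm c = 1 \<and>
        (\<forall>z\<in>ball 0 1. B z = c * (\<Prod>\<beta>\<leftarrow>zs. (\<beta> - z) / (1 - cnj \<beta> * z))))"


section \<open>The induced module is a persistence module\<close>

definition fsubspace :: "('b \<Rightarrow>\<^sub>0 'f::field) set \<Rightarrow> bool" where
  "fsubspace B \<longleftrightarrow> 0 \<in> B \<and> (\<forall>x\<in>B. \<forall>y\<in>B. x + y \<in> B) \<and> (\<forall>a. \<forall>x\<in>B. fscale a x \<in> B)"

lemma lookup_fscale [simp]: "Poly_Mapping.lookup (fscale a c) k = a * Poly_Mapping.lookup c k"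
  by (simp add: fscale_def Poly_Mapping.map.rep_eq when_def)

lemma fscale_simps:
  "fscale a (x + y) = fscale a x + fscale a y"
  "fscale (a + b) x = fscale a x + fscale b x"
  "fscale (a * b) x = fscale a (fscale b x)"
  "fscale 1 x = x" "fscale 0 x = 0" "fscale a 0 = 0" "fscale (-1) x = - x"
  by (rule poly_mapping_eqI; simp add: lookup_add algebra_simps)+

lemma fsubspace_uminus: "fsubspace B \<Longrightarrow> x \<in> B \<Longrightarrow> - x \<in> B"
  unfolding fsubspace_def by (metis fscale_simps(7))

lemma fboundary_superset:
  assumes "finite S" "Poly_Mapping.keys c \<subseteq> S" "p \<noteq> 0"
  shows "fboundary p c = (\<Sum>\<sigma>\<in>S. \<Sum>k\<le>p.
           Poly_Mapping.single (singular_face p k \<sigma>) ((-1) ^ k * Poly_Mapping.lookup c \<sigma>))"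
  unfolding fboundary_def using assms
  by (auto intro!: sum.mono_neutral_left simp: in_keys_iff)

lemma fboundary_add: "fboundary p (c + d) = fboundary p c + fboundary p d"
proof (cases "p = 0")
  case False
  define S where "S = Poly_Mapping.keys c \<union> Poly_Mapping.keys d"
  have S: "finite S" "Poly_Mapping.keys c \<subseteq> S" "Poly_Mapping.keys d \<subseteq> S"
    "Poly_Mapping.keys (c + d) \<subseteq> S"
    unfolding S_def using Poly_Mapping.keys_add[of c d] by auto
  show ?thesis
    unfolding fboundary_superset[OF S(1,2) False] fboundary_superset[OF S(1,3) False]
      fboundary_superset[OF S(1,4) False]
    by (simp add: lookup_add distrib_left single_add sum.distrib)
qed (simp add: fboundary_def)

lemma fscale_sum: "fscale a (\<Sum>i\<in>I. f i) = (\<Sum>i\<in>I. fscale a (f i))"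
  by (induction I rule: infinite_finite_induct) (simp_all add: fscale_simps)

lemma fscale_single: "fscale a (Poly_Mapping.single k x) = Poly_Mapping.single k (a * x)"
  by (rule poly_mapping_eqI) (simp add: lookup_single when_def)

lemma keys_fscale: "Poly_Mapping.keys (fscale a c) \<subseteq> Poly_Mapping.keys c"
  by (auto simp: in_keys_iff)

lemma fboundary_scale: "fboundary p (fscale a c) = fscale a (fboundary p c)"
proof (cases "p = 0")
  case False
  show ?thesis
    unfolding fboundary_superset[OF finite_keys keys_fscale[of a c] False]
      fboundary_superset[OF finite_keys[of c] order_refl False]
    by (simp add: fscale_sum fscale_single mult.left_commute)
qed (simp add: fboundary_def fscale_simps)

lemma fboundary_0 [simp]: "fboundary p 0 = 0"
  by (simp add: fboundary_def)

lemma fsubspace_fchains: "fsubspace (fchains p X)"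
  unfolding fsubspace_def fchains_def
  using Poly_Mapping.keys_add keys_fscale by (fastforce dest: subsetD)

lemma fsubspace_fcycles: "fsubspace (fcycles p X)"
  using fsubspace_fchains[of p X] unfolding fsubspace_def fcycles_def
  by (auto simp: fboundary_add fboundary_scale fscale_simps)

lemma fsubspace_fboundaries: "fsubspace (fboundaries p X)"
  using fsubspace_fchains[of "Suc p" X] unfolding fsubspace_def fboundaries_def
  by (auto simp flip: fboundary_add fboundary_scale)
     (metis fboundary_0 imageI)

lemma fboundaries_mono:
  assumes "S \<subseteq> T"
  shows "fboundaries p (top_of_set S) \<subseteq> fboundaries p (top_of_set T)"
proof -
  have "singular_simplex q (top_of_set S) f \<Longrightarrow> singular_simplex q (top_of_set T) f" for q f
    using assms by (auto simp: singular_simplex_def continuous_map_in_subtopology)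
  then show ?thesis
    unfolding fboundaries_def fchains_def by (intro image_mono) blast
qed

lemma fcycles_mono:
  assumes "S \<subseteq> T"
  shows "fcycles p (top_of_set S) \<subseteq> fcycles p (top_of_set T)"
proof -
  have "singular_simplex q (top_of_set S) f \<Longrightarrow> singular_simplex q (top_of_set T) f" for q f
    using assms by (auto simp: singular_simplex_def continuous_map_in_subtopology)
  then show ?thesis
    unfolding fcycles_def fchains_def by blast
qed

lemma coset_add:
  assumes "fsubspace B" "fsubspace C" "B \<subseteq> C"
  shows "{x + y |x y. x \<in> (+) z ` B \<and> y \<in> (+) w ` C} = (+) (z + w) ` C"
proof (intro equalityI subsetI)
  fix v assume "v \<in> {x + y |x y. x \<in> (+) z ` B \<and> y \<in> (+) w ` C}"
  then obtain b c where "v = (z + b) + (w + c)" "b \<in> B" "c \<in> C" by auto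
  then have "v = (z + w) + (b + c)" "b + c \<in> C"
    using assms by (auto simp: algebra_simps fsubspace_def)
  then show "v \<in> (+) (z + w) ` C" by blast
next
  fix v assume "v \<in> (+) (z + w) ` C"
  then obtain c where c: "c \<in> C" "v = z + w + c" by auto
  then have "v = (z + 0) + (w + c)" by (simp add: algebra_simps)
  moreover have "0 \<in> B" using assms by (simp add: fsubspace_def)
  ultimately show "v \<in> {x + y |x y. x \<in> (+) z ` B \<and> y \<in> (+) w ` C}" using c by blast
qed

lemma coset_smult:
  assumes "fsubspace B"
  shows "{fscale a x + b |x b. x \<in> (+) z ` B \<and> b \<in> B} = (+) (fscale a z) ` B"
proof (intro equalityI subsetI)
  fix v assume "v \<in> {fscale a x + b |x b. x \<in> (+) z ` B \<and> b \<in> B}"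
  then obtain b c where bc: "v = fscale a (z + b) + c" "b \<in> B" "c \<in> B" by auto
  then have "v = fscale a z + (fscale a b + c)" "fscale a b + c \<in> B"
    using assms by (auto simp: algebra_simps fsubspace_def fscale_simps)
  then show "v \<in> (+) (fscale a z) ` B" by blast
next
  fix v assume "v \<in> (+) (fscale a z) ` B"
  then obtain c where c: "c \<in> B" "v = fscale a z + c" by auto
  then have "v = fscale a (z + 0) + c" "0 \<in> B"
    using assms by (auto simp: fsubspace_def)
  then show "v \<in> {fscale a x + b |x b. x \<in> (+) z ` B \<and> b \<in> B}" using c by blast
qed

lemma module_quotient_space:
  fixes B Z :: "('b \<Rightarrow>\<^sub>0 'f::field) set"
  assumes B: "fsubspace B" and Z: "fsubspace Z"
  shows "Module.module (ring_of_type_algebra :: 'f ring) (quotient_space Z B)"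
proof -
  let ?R = "ring_of_type_algebra :: 'f ring" and ?Q = "quotient_space Z B"
  have car: "carrier ?Q = (\<lambda>z. (+) z ` B) ` Z" and zero: "\<zero>\<^bsub>?Q\<^esub> = (+) 0 ` B"
    by (simp_all add: quotient_space_def)
  have add: "(+) z ` B \<oplus>\<^bsub>?Q\<^esub> (+) w ` B = (+) (z + w) ` B" for z w
    using coset_add[OF B B order_refl, of z w] by (simp add: quotient_space_def)
  have smult: "a \<odot>\<^bsub>?Q\<^esub> (+) z ` B = (+) (fscale a z) ` B" for a z
    using coset_smult[OF B, of a z] by (simp add: quotient_space_def)
  have Zc: "0 \<in> Z" "x + y \<in> Z" "fscale a x \<in> Z" "- x \<in> Z" if "x \<in> Z" "y \<in> Z" for x y a
    using Z that fsubspace_uminus[OF Z] by (auto simp: fsubspace_def)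
  have Z0: "0 \<in> Z" using Z by (simp add: fsubspace_def)
  have R: "cring ?R" by (rule cring_from_type_algebra)
  have G: "abelian_group ?Q"
  proof (rule abelian_groupI)
    fix X assume "X \<in> carrier ?Q"
    then obtain z where "z \<in> Z" "X = (+) z ` B" by (auto simp: car)
    then show "\<exists>Y\<in>carrier ?Q. Y \<oplus>\<^bsub>?Q\<^esub> X = \<zero>\<^bsub>?Q\<^esub>"
      unfolding car zero using Zc(4)[of z z] by (intro bexI[of _ "(+) (- z) ` B"]) (auto simp only: add left_minus)
  next
    fix X assume "X \<in> carrier ?Q"
    then show "\<zero>\<^bsub>?Q\<^esub> \<oplus>\<^bsub>?Q\<^esub> X = X"
      by (auto simp only: car zero add add_0)
  next
    show "\<zero>\<^bsub>?Q\<^esub> \<in> carrier ?Q" using Z0 by (auto simp only: car zero)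
  next
    fix X Y assume "X \<in> carrier ?Q" "Y \<in> carrier ?Q"
    then obtain z w where zw: "z \<in> Z" "w \<in> Z" "X = (+) z ` B" "Y = (+) w ` B"
      by (auto simp: car)
    show "X \<oplus>\<^bsub>?Q\<^esub> Y \<in> carrier ?Q"
      unfolding car zw add using Zc(2)[OF zw(1,2)] by blast
    show "X \<oplus>\<^bsub>?Q\<^esub> Y = Y \<oplus>\<^bsub>?Q\<^esub> X"
      unfolding zw add by (simp only: add.commute)
  next
    fix X Y W assume "X \<in> carrier ?Q" "Y \<in> carrier ?Q" "W \<in> carrier ?Q"
    then show "X \<oplus>\<^bsub>?Q\<^esub> Y \<oplus>\<^bsub>?Q\<^esub> W = X \<oplus>\<^bsub>?Q\<^esub> (Y \<oplus>\<^bsub>?Q\<^esub> W)"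
      by (auto simp only: car add add.assoc)
  qed
  show ?thesis
    by (rule moduleI[OF R G])
       (use Zc in \<open>auto simp only: car add smult fscale_simps ring_of_type_algebra_def
          ring.simps monoid.simps partial_object.simps intro!: imageI\<close>)
qed

lemma module_zero_space:
  "Module.module (ring_of_type_algebra :: 'f::field ring) (zero_space z)"
proof (rule moduleI)
  show "cring (ring_of_type_algebra :: 'f ring)" by (rule cring_from_type_algebra)
  show "abelian_group (zero_space z)"
    by (rule abelian_groupI) (auto simp: zero_space_def)
qed (auto simp: zero_space_def)

lemma theta_mono:
  assumes "s \<le> t" shows "theta s \<le> theta t"
proof -
  have "theta r = 1 - 2 / (exp r + 1)" for r
  proof -
    have "exp r + 1 \<noteq> 0" using add_pos_pos[OF exp_gt_zero[of r] zero_less_one] by simp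
    moreover have "theta r = (exp r + 1 - 2) / (exp r + 1)" by (simp add: theta_def)
    ultimately show ?thesis by (metis diff_divide_distrib divide_self)
  qed
  then show ?thesis
    using assms by (simp add: add_pos_pos frac_le)
qed

lemma sublevel_mono: "s \<le> t \<Longrightarrow> sublevel u s \<subseteq> sublevel u t"
  using theta_mono by (fastforce simp: sublevel_def)

theorem persistence_module_induced:
  "persistence_module (induced_pmodule u :: ('f::field, (complex, 'f) fchain set) pmodule)"
proof -
  let ?V = "induced_pmodule u :: ('f, (complex, 'f) fchain set) pmodule"
  let ?S = "induced_space u :: real \<Rightarrow> ('f, (complex, 'f) fchain set) module"
  define Z :: "real \<Rightarrow> (complex, 'f) fchain set" where "Z t = fcycles 0 (top_of_set (sublevel u t))" for t
  define B :: "real \<Rightarrow> (complex, 'f) fchain set" where "B t = fboundaries 0 (top_of_set (sublevel u t))" for t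
  have Zs: "fsubspace (Z t)" and Bs: "fsubspace (B t)" for t
    by (simp_all add: Z_def B_def fsubspace_fcycles fsubspace_fboundaries)
  have mono: "Z s \<subseteq> Z t" "B s \<subseteq> B t" if "s \<le> t" for s t
    using that by (simp_all add: Z_def B_def fcycles_mono fboundaries_mono sublevel_mono)
  have pos: "?S t = quotient_space (Z t) (B t)" if "t > 0" for t
    using that by (simp add: induced_space_def homology_space_def Z_def B_def)
  have neg: "?S t = zero_space {0}" if "t \<le> 0" for t
    using that by (simp add: induced_space_def)
  have sp: "space ?V = ?S" by (simp add: induced_pmodule_def)
  have m: "Module.module (ring_of_type_algebra :: 'f ring) (?S t)" for t
    by (cases "t > 0") (simp_all add: pos neg Zs Bs module_quotient_space module_zero_space)
  have car: "carrier (?S t) = (\<lambda>z. (+) z ` B t) ` Z t" if "t > 0" for t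
    using that by (simp add: pos quotient_space_def)
  have add: "(+) z ` B t \<oplus>\<^bsub>?S t\<^esub> (+) w ` B t = (+) (z + w) ` B t" if "t > 0" for t z w
    using coset_add[OF Bs[of t] Bs order_refl, of z w] that by (simp add: pos quotient_space_def)
  have smult: "a \<odot>\<^bsub>?S t\<^esub> (+) z ` B t = (+) (fscale a z) ` B t" if "t > 0" for a z t
    using coset_smult[OF Bs[of t], of a z] that by (simp add: pos quotient_space_def)
  have map_pos: "smap ?V s t ((+) z ` B s) = (+) z ` B t" if "s > 0" "s \<le> t" for s t z
    using coset_add[OF Bs Bs mono(2)[OF that(2)], of z 0] that
    by (simp add: induced_pmodule_def homology_inclusion_def flip: B_def)
  have map_neg: "smap ?V s t X = \<zero>\<^bsub>?S t\<^esub>" if "s \<le> 0" for s t X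
    using that by (simp add: induced_pmodule_def)
  have zero_pos: "\<zero>\<^bsub>?S t\<^esub> = (+) 0 ` B t" if "t > 0" for t
    using that by (simp add: pos quotient_space_def)
  have Zc: "x + y \<in> Z t" "fscale a x \<in> Z t" if "x \<in> Z t" "y \<in> Z t" for x y a t
    using Zs[of t] that by (auto simp: fsubspace_def)
  have lin: "linear_on (?S s) (?S t) (smap ?V s t)" if st: "s \<le> t" for s t
  proof (cases "s > 0")
    case True
    then have "t > 0" using st by simp
    show ?thesis
      unfolding linear_on_def
      using subsetD[OF mono(1)[OF st]]
      by (auto simp only: car[OF True] car[OF \<open>t > 0\<close>] add[OF True] add[OF \<open>t > 0\<close>]
          smult[OF True] smult[OF \<open>t > 0\<close>] map_pos[OF True st] Pi_iff intro!: imageI)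
  next
    case False
    interpret M: Module.module "ring_of_type_algebra :: 'f ring" "?S t" by (rule m)
    have "a \<odot>\<^bsub>?S t\<^esub> \<zero>\<^bsub>?S t\<^esub> = \<zero>\<^bsub>?S t\<^esub>" for a
      using M.smult_r_null[of a] by (simp add: ring_of_type_algebra_def)
    with False show ?thesis
      unfolding linear_on_def by (simp add: map_neg)
  qed
  have comp: "smap ?V s r X = smap ?V t r (smap ?V s t X)"
    if "s \<le> t" "t \<le> r" and in_s: "X \<in> carrier (?S s)" for s t r X
  proof (cases "s > 0")
    case True
    then obtain z where "X = (+) z ` B s" using in_s unfolding car[OF True] by blast
    then show ?thesis using True that by (simp add: map_pos)
  next
    case s: False
    show ?thesis
    proof (cases "t > 0")
      case True
      then have "r > 0" using that by simp
      with True s that show ?thesis by (simp only: map_neg not_less zero_pos map_pos)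
    qed (use s in \<open>simp add: map_neg\<close>)
  qed
  have ident: "smap ?V t t X = X" if "X \<in> carrier (?S t)" for t X
  proof (cases "t > 0")
    case True
    then show ?thesis using that by (auto simp: car map_pos)
  next
    case False
    then show ?thesis using that by (simp add: map_neg neg zero_space_def)
  qed
  have small: "\<forall>s<0. carrier (?S s) = {\<zero>\<^bsub>?S s\<^esub>}"
    by (simp add: neg zero_space_def)
  show ?thesis
    unfolding persistence_module_def sp
    using m lin comp ident small by blast
qed

end

theory Submission
  imports Defs "HOL-Library.Product_Plus" "HOL-Analysis.Complex_Transcendental"
begin

text \<open>
  An automorphism of the disc carries the hyperbolic midpoint of the two zeros to the origin and the
  zeros to \<open>\<plusminus>\<mu>\<close>. There \<open>\<bar>B\<bar>\<close> is the pseudo-hyperbolic distance of \<open>z\<^sup>2\<close> and \<open>\<mu>\<^sup>2\<close>, so a sublevel set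
  is the preimage under squaring of a Euclidean disc. If that disc contains \<open>0\<close>, the preimage is
  star-shaped; otherwise the two branches of the square root split it into two path components. Hence
  the induced module has the bars \<open>(0, \<infinity>)\<close> and \<open>(0, T]\<close> with \<open>theta T = \<bar>\<mu>\<bar>\<^sup>2\<close>, which means
  \<open>T = ln (1 / sqrt (1 - \<bar>w\<bar>\<^sup>2))\<close>. For two such modules with finite bars \<open>(0, S]\<close> and \<open>(0, T]\<close>, one
  either deletes both finite bars or matches them. No other interleaving is cheaper: if \<open>T \<le> S\<close> and
  \<open>\<Delta> < min (S / 2) (S - T)\<close>, the identity of a two-dimensional space would factor through a line.
\<close>

section \<open>Isomorphisms and interleavings\<close>

text \<open>The inverse laws are asked on carriers only, since the maps are total functions on whole
  types. The element types may differ, which lets cosets of chains be exchanged for pairs of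
  scalars.\<close>

definition pm_isomorphic :: "('f, 'v) pmodule \<Rightarrow> ('f, 'w) pmodule \<Rightarrow> bool" where
  "pm_isomorphic V W \<longleftrightarrow>
     (\<exists>\<Phi> \<Psi>. pm_morphism V W \<Phi> \<and> pm_morphism W V \<Psi> \<and>
        (\<forall>t. \<forall>x\<in>carrier (space V t). \<Psi> t (\<Phi> t x) = x) \<and>
        (\<forall>t. \<forall>y\<in>carrier (space W t). \<Phi> t (\<Psi> t y) = y))"

lemma pm_isomorphic_sym: "pm_isomorphic V W \<Longrightarrow> pm_isomorphic W V"
  unfolding pm_isomorphic_def by blast

lemma pm_morphism_compose:
  assumes "pm_morphism V W F" "pm_morphism W U G"
  shows "pm_morphism V U (\<lambda>t x. G t (F t x))"
  using assms unfolding pm_morphism_def linear_on_def Pi_iff by simp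

lemma pm_morphism_shift:
  "pm_morphism V W F \<Longrightarrow> pm_morphism (shift \<Delta> V) (shift \<Delta> W) (\<lambda>t. F (t + \<Delta>))"
  unfolding pm_morphism_def shift_def by simp


lemma pm_morphism_carrier:
  "pm_morphism V W F \<Longrightarrow> x \<in> carrier (space V t) \<Longrightarrow> F t x \<in> carrier (space W t)"
  unfolding pm_morphism_def linear_on_def by auto

lemma pm_morphism_smap:
  "pm_morphism V W F \<Longrightarrow> s \<le> t \<Longrightarrow> x \<in> carrier (space V s) \<Longrightarrow>
    F t (smap V s t x) = smap W s t (F s x)"
  unfolding pm_morphism_def by auto

text \<open>Conjugate both interleaving morphisms by the isomorphisms. In each composite the inner
  inverse pair cancels, and naturality carries the outer map past the transition by
  \<open>2 * \<Delta>\<close>.\<close>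

lemma interleaved_isomorphic:
  assumes "pm_isomorphic V V'" "pm_isomorphic W W'" "interleaved \<Delta> V W" "\<Delta> \<ge> 0"
  shows "interleaved \<Delta> V' W'"
proof -
  obtain \<Phi> \<Phi>' where \<Phi>: "pm_morphism V V' \<Phi>" "pm_morphism V' V \<Phi>'"
    "\<And>t x. x \<in> carrier (space V t) \<Longrightarrow> \<Phi>' t (\<Phi> t x) = x"
    "\<And>t y. y \<in> carrier (space V' t) \<Longrightarrow> \<Phi> t (\<Phi>' t y) = y"
    using assms(1) unfolding pm_isomorphic_def by blast
  obtain \<Psi> \<Psi>' where \<Psi>: "pm_morphism W W' \<Psi>" "pm_morphism W' W \<Psi>'"
    "\<And>t x. x \<in> carrier (space W t) \<Longrightarrow> \<Psi>' t (\<Psi> t x) = x"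
    "\<And>t y. y \<in> carrier (space W' t) \<Longrightarrow> \<Psi> t (\<Psi>' t y) = y"
    using assms(2) unfolding pm_isomorphic_def by blast
  obtain F G where FG: "pm_morphism V (shift \<Delta> W) F" "pm_morphism W (shift \<Delta> V) G"
    "\<And>t x. x \<in> carrier (space V t) \<Longrightarrow> G (t + \<Delta>) (F t x) = smap V t (t + 2 * \<Delta>) x"
    "\<And>t y. y \<in> carrier (space W t) \<Longrightarrow> F (t + \<Delta>) (G t y) = smap W t (t + 2 * \<Delta>) y"
    using assms(3) unfolding interleaved_def shift_morphism_def shift_transition_def by blast
  have sp: "space (shift \<Delta> A) t = space A (t + \<Delta>)" for A :: "('x, 'y) pmodule" and t
    by (simp add: shift_def)
  have car: "F t x \<in> carrier (space W (t + \<Delta>))" if "x \<in> carrier (space V t)" for t x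
    using pm_morphism_carrier[OF FG(1) that] by (simp add: sp)
  have car': "G t x \<in> carrier (space V (t + \<Delta>))" if "x \<in> carrier (space W t)" for t x
    using pm_morphism_carrier[OF FG(2) that] by (simp add: sp)
  define F' where "F' t x = \<Psi> (t + \<Delta>) (F t (\<Phi>' t x))" for t x
  define G' where "G' t x = \<Phi> (t + \<Delta>) (G t (\<Psi>' t x))" for t x
  have "pm_morphism V' (shift \<Delta> W') (\<lambda>t x. \<Psi> (t + \<Delta>) (F t (\<Phi>' t x)))"
    by (rule pm_morphism_compose[OF pm_morphism_compose[OF \<Phi>(2) FG(1)] pm_morphism_shift[OF \<Psi>(1)]])
  moreover have "pm_morphism W' (shift \<Delta> V') (\<lambda>t x. \<Phi> (t + \<Delta>) (G t (\<Psi>' t x)))"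
    by (rule pm_morphism_compose[OF pm_morphism_compose[OF \<Psi>(2) FG(2)] pm_morphism_shift[OF \<Phi>(1)]])
  moreover have "G' (t + \<Delta>) (F' t x) = smap V' t (t + 2 * \<Delta>) x" if "x \<in> carrier (space V' t)" for t x
  proof -
    have x: "\<Phi>' t x \<in> carrier (space V t)"
      by (rule pm_morphism_carrier[OF \<Phi>(2) that])
    have "G' (t + \<Delta>) (F' t x) = \<Phi> (t + 2 * \<Delta>) (smap V t (t + 2 * \<Delta>) (\<Phi>' t x))"
      unfolding F'_def G'_def using FG(3)[OF x] \<Psi>(3)[OF car[OF x]] by (simp add: algebra_simps)
    also have "\<dots> = smap V' t (t + 2 * \<Delta>) (\<Phi> t (\<Phi>' t x))"
      using pm_morphism_smap[OF \<Phi>(1) _ x] assms(4) by simp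
    finally show ?thesis using \<Phi>(4)[OF that] by simp
  qed
  moreover have "F' (t + \<Delta>) (G' t x) = smap W' t (t + 2 * \<Delta>) x" if "x \<in> carrier (space W' t)" for t x
  proof -
    have x: "\<Psi>' t x \<in> carrier (space W t)"
      by (rule pm_morphism_carrier[OF \<Psi>(2) that])
    have "F' (t + \<Delta>) (G' t x) = \<Psi> (t + 2 * \<Delta>) (smap W t (t + 2 * \<Delta>) (\<Psi>' t x))"
      unfolding F'_def G'_def using FG(4)[OF x] \<Phi>(3)[OF car'[OF x]] by (simp add: algebra_simps)
    also have "\<dots> = smap W' t (t + 2 * \<Delta>) (\<Psi> t (\<Psi>' t x))"
      using pm_morphism_smap[OF \<Psi>(1) _ x] assms(4) by simp
    finally show ?thesis using \<Psi>(4)[OF that] by simp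
  qed
  ultimately show ?thesis
    unfolding interleaved_def shift_morphism_def shift_transition_def F'_def G'_def by blast
qed

lemma interleaving_distance_isomorphic:
  assumes "pm_isomorphic V V'" "pm_isomorphic W W'"
  shows "interleaving_distance V W = interleaving_distance V' W'"
proof -
  have "interleaved \<Delta> V W \<longleftrightarrow> interleaved \<Delta> V' W'" if "\<Delta> > 0" for \<Delta>
    using interleaved_isomorphic[OF assms] that
      interleaved_isomorphic[OF assms[THEN pm_isomorphic_sym]] by (meson less_imp_le)
  then show ?thesis
    unfolding interleaving_distance_def by (metis (no_types, lifting))
qed

text \<open>Linearity and naturality of the pointwise inverses follow by applying
  \<open>\<Phi>\<close> and cancelling it by injectivity. The module laws of \<open>V\<close> keep
  the sums and multiples concerned inside the carrier.\<close>

lemma pm_isomorphicI: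
  assumes V: "persistence_module V" and \<Phi>: "pm_morphism V W \<Phi>"
    and bij: "\<And>t. bij_betw (\<Phi> t) (carrier (space V t)) (carrier (space W t))"
  shows "pm_isomorphic V W"
proof -
  let ?\<Psi> = "\<lambda>t. inv_into (carrier (space V t)) (\<Phi> t)"
  have r: "\<Phi> t (?\<Psi> t y) = y" if "y \<in> carrier (space W t)" for t y
    using bij_betw_inv_into_right[OF bij that] .
  have l: "?\<Psi> t (\<Phi> t x) = x" if "x \<in> carrier (space V t)" for t x
    using bij_betw_inv_into_left[OF bij that] .
  have c: "?\<Psi> t y \<in> carrier (space V t)" if "y \<in> carrier (space W t)" for t y
    using bij_betw_apply[OF bij_betw_inv_into[OF bij] that] .
  have lin: "linear_on (space V t) (space W t) (\<Phi> t)" for t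
    using \<Phi> unfolding pm_morphism_def by blast
  have "linear_on (space W t) (space V t) (?\<Psi> t)" for t
  proof -
    interpret M: Module.module "ring_of_type_algebra :: 'a ring" "space V t"
      using V unfolding persistence_module_def by blast
    have sm: "a \<odot>\<^bsub>space V t\<^esub> x \<in> carrier (space V t)" if "x \<in> carrier (space V t)" for a x
      using M.smult_closed[OF _ that, of a] by (simp add: ring_of_type_algebra_def)
    show ?thesis
      unfolding linear_on_def
    proof (intro conjI ballI allI funcsetI)
      fix y z assume yz: "y \<in> carrier (space W t)" "z \<in> carrier (space W t)"
      have "\<Phi> t (?\<Psi> t y \<oplus>\<^bsub>space V t\<^esub> ?\<Psi> t z) = y \<oplus>\<^bsub>space W t\<^esub> z"
        using lin[of t] c yz unfolding linear_on_def by (simp add: r)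
      then show "?\<Psi> t (y \<oplus>\<^bsub>space W t\<^esub> z) = ?\<Psi> t y \<oplus>\<^bsub>space V t\<^esub> ?\<Psi> t z"
        by (metis l M.add.m_closed c yz)
    next
      fix a y assume y: "y \<in> carrier (space W t)"
      have "\<Phi> t (a \<odot>\<^bsub>space V t\<^esub> ?\<Psi> t y) = a \<odot>\<^bsub>space W t\<^esub> y"
        using lin[of t] c y unfolding linear_on_def by (simp add: r)
      then show "?\<Psi> t (a \<odot>\<^bsub>space W t\<^esub> y) = a \<odot>\<^bsub>space V t\<^esub> ?\<Psi> t y"
        by (metis l sm c y)
    qed (rule c)
  qed
  moreover have "?\<Psi> t (smap W s t y) = smap V s t (?\<Psi> s y)"
    if "s \<le> t" "y \<in> carrier (space W s)" for s t y
  proof -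
    have "smap V s t (?\<Psi> s y) \<in> carrier (space V t)"
      using V c[OF that(2)] that(1) unfolding persistence_module_def linear_on_def by blast
    moreover have "\<Phi> t (smap V s t (?\<Psi> s y)) = smap W s t y"
      using pm_morphism_smap[OF \<Phi> that(1) c[OF that(2)]] r[OF that(2)] by simp
    ultimately show ?thesis by (metis l)
  qed
  ultimately have "pm_morphism W V ?\<Psi>"
    unfolding pm_morphism_def by blast
  with \<Phi> l r show ?thesis
    unfolding pm_isomorphic_def by blast
qed

text \<open>The sum of the interval modules of \<open>(0, \<infinity>)\<close> and \<open>(0, T]\<close>.\<close>

definition two_bar_module :: "real \<Rightarrow> ('f::field, 'f \<times> 'f) pmodule" where
  "two_bar_module T =
     \<lparr>space = (\<lambda>t. \<lparr>carrier = {p. (t \<le> 0 \<longrightarrow> fst p = 0) \<and> (t \<le> 0 \<or> T < t \<longrightarrow> snd p = 0)},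
        monoid.mult = undefined, monoid.one = undefined, ring.zero = 0, ring.add = (+),
        module.smult = (\<lambda>a p. (a * fst p, a * snd p))\<rparr>),
      smap = (\<lambda>s t p. (fst p, if t \<le> T then snd p else 0))\<rparr>"

section \<open>Interleavings between two-bar modules\<close>

lemma interleaved_sym: "interleaved \<Delta> V W \<longleftrightarrow> interleaved \<Delta> W V"
  unfolding interleaved_def by blast

text \<open>Both morphisms keep the infinite bar and delete the finite one. The transitions by
  \<open>2 * \<Delta>\<close> delete it as well, because no finite bar is longer than that.\<close>

lemma interleaved_two_bar_half:
  assumes "\<Delta> \<ge> S / 2" "\<Delta> \<ge> T / 2" "\<Delta> > 0"
  shows "interleaved \<Delta> (two_bar_module S :: ('f::field, 'f \<times> 'f) pmodule) (two_bar_module T)"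
  unfolding interleaved_def
  using assms
  by (intro exI[of _ "\<lambda>t p. (fst p, 0)"])
    (auto simp: pm_morphism_def linear_on_def two_bar_module_def shift_def
      shift_morphism_def shift_transition_def)

text \<open>The finite bars are matched: the second coordinate is kept while the target bar is
  alive. If \<open>t + 2 * \<Delta> \<le> S\<close> then \<open>t + \<Delta> \<le> T\<close>, and
  symmetrically, so neither composite loses it too early.\<close>

lemma interleaved_two_bar_diff:
  assumes "\<Delta> \<ge> \<bar>S - T\<bar>" "\<Delta> > 0"
  shows "interleaved \<Delta> (two_bar_module S :: ('f::field, 'f \<times> 'f) pmodule) (two_bar_module T)"
  unfolding interleaved_def
  using assms
  by (intro exI[of _ "\<lambda>t p. (fst p, if t + \<Delta> \<le> T then snd p else 0)"]
      exI[of _ "\<lambda>t p. (fst p, if t + \<Delta> \<le> S then snd p else 0)"])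
    (auto simp: pm_morphism_def linear_on_def two_bar_module_def shift_def
      shift_morphism_def shift_transition_def)

lemma not_interleaved_two_bar:
  assumes "\<Delta> < S / 2" "\<Delta> < S - T" "\<Delta> > 0"
  shows "\<not> interleaved \<Delta> (two_bar_module S :: ('f::field, 'f \<times> 'f) pmodule) (two_bar_module T)"
proof
  let ?V = "two_bar_module S :: ('f, 'f \<times> 'f) pmodule" and ?W = "two_bar_module T :: ('f, 'f \<times> 'f) pmodule"
  assume "interleaved \<Delta> ?V ?W"
  then obtain F G where F: "pm_morphism ?V (shift \<Delta> ?W) F" and G: "pm_morphism ?W (shift \<Delta> ?V) G"
    and GF: "\<And>t x. x \<in> carrier (space ?V t) \<Longrightarrow> G (t + \<Delta>) (F t x) = smap ?V t (t + 2 * \<Delta>) x"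
    unfolding interleaved_def shift_morphism_def shift_transition_def by blast
  \<comment> \<open>The last time at which the transition by \<open>2 * \<Delta>\<close> is still
    the identity, the bar being closed at \<open>S\<close>. Halfway, at
    \<open>S - \<Delta> > T\<close>, the other module is already a line.\<close>
  define t where "t = S - 2 * \<Delta>"
  have t: "0 < t" "t \<le> S" "T < t + \<Delta>" "t + 2 * \<Delta> = S" "0 < t + \<Delta>"
    using assms by (auto simp: t_def field_simps)
  have car: "carrier (space ?V t) = UNIV" "carrier (space ?W (t + \<Delta>)) = {p. snd p = 0}"
    using t by (auto simp: two_bar_module_def)
  have inj: "G (t + \<Delta>) (F t x) = x" for x
    using GF[of x t] t car by (simp add: two_bar_module_def)
  have lin: "linear_on (space ?V t) (space ?W (t + \<Delta>)) (F t)"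
    using F unfolding pm_morphism_def by (simp add: shift_def)
  then have sm: "F t (a * fst p, a * snd p) = (a * fst (F t p), a * snd (F t p))"
    and snd0: "snd (F t p) = 0" for a p
    unfolding linear_on_def car by (auto simp: two_bar_module_def)
  \<comment> \<open>The images of the two basis vectors in the line. Both \<open>(b, 0)\<close> and
    \<open>(0, a)\<close> go to \<open>a * b\<close>, so injectivity forces
    \<open>a = b = 0\<close>, and then both basis vectors are sent to zero.\<close>
  define a b where "a = fst (F t (1, 0))" and "b = fst (F t (0, 1))"
  have ab: "F t (1, 0) = (a, 0)" "F t (0, 1) = (b, 0)"
    using snd0 by (simp_all add: a_def b_def prod_eq_iff)
  have "F t (b, 0) = F t (0, a)"
    using sm[of b "(1, 0)"] sm[of a "(0, 1)"] ab by (simp add: mult.commute)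
  then have "(b, 0) = (0, a)" by (metis inj)
  then have "F t (1, 0) = F t (0, 1)" using ab by simp
  then have "(1::'f, 0::'f) = (0, 1)" by (metis inj)
  then show False by simp
qed

lemma interleaving_distance_two_bar:
  assumes "S \<ge> 0" "T \<ge> 0"
  shows "interleaving_distance (two_bar_module S :: ('f::field, 'f \<times> 'f) pmodule) (two_bar_module T) =
    ereal (min (max (S / 2) (T / 2)) \<bar>S - T\<bar>)" (is "_ = ereal ?d")
proof -
  have "interleaved \<Delta> (two_bar_module S :: ('f, 'f \<times> 'f) pmodule) (two_bar_module T) \<longleftrightarrow> ?d \<le> \<Delta>"
    if "\<Delta> > 0" for \<Delta>
  proof
    assume "?d \<le> \<Delta>"
    then show "interleaved \<Delta> (two_bar_module S :: ('f, 'f \<times> 'f) pmodule) (two_bar_module T)"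
      using interleaved_two_bar_half interleaved_two_bar_diff that
      by (metis max.bounded_iff min_le_iff_disj)
  next
    assume *: "interleaved \<Delta> (two_bar_module S :: ('f, 'f \<times> 'f) pmodule) (two_bar_module T)"
    show "?d \<le> \<Delta>"
    \<comment> \<open>A \<open>\<Delta>\<close> below \<open>?d\<close> lies below both entries of
      the minimum. With the longer finite bar put first, these are half its length and the
      difference of the lengths.\<close>
    proof (cases "T \<le> S")
      case True
      then show ?thesis using * not_interleaved_two_bar[of \<Delta> S T] that by fastforce
    next
      case False
      then show ?thesis
        using * not_interleaved_two_bar[of \<Delta> T S] that interleaved_sym by fastforce
    qed
  qed
  then have eq: "interleaving_distance (two_bar_module S :: ('f, 'f \<times> 'f) pmodule) (two_bar_module T) =
      Inf {ereal \<Delta> |\<Delta>. 0 < \<Delta> \<and> ?d \<le> \<Delta>}"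
    unfolding interleaving_distance_def by (metis (no_types, lifting))
  have "?d \<ge> 0" using assms by auto
  show ?thesis
    unfolding eq
  proof (rule Inf_eqI)
    fix y assume y: "\<And>i. i \<in> {ereal \<Delta> |\<Delta>. 0 < \<Delta> \<and> ?d \<le> \<Delta>} \<Longrightarrow> y \<le> i"
    show "y \<le> ereal ?d"
    proof (rule ereal_le_epsilon2)
      fix e :: real assume "0 < e"
      then have "y \<le> ereal (?d + e)"
        using \<open>?d \<ge> 0\<close> by (intro y CollectI exI[of _ "?d + e"]) (intro conjI refl; linarith)
      then show "y \<le> ereal ?d + ereal e" by (simp only: plus_ereal.simps)
    qed
  next
    fix i assume "i \<in> {ereal \<Delta> |\<Delta>. 0 < \<Delta> \<and> ?d \<le> \<Delta>}"
    then obtain \<Delta> where "i = ereal \<Delta>" "?d \<le> \<Delta>" by blast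
    then show "ereal ?d \<le> i" by (simp only: ereal_less_eq)
  qed
qed

section \<open>Singular homology in degree zero\<close>

text \<open>The only point of \<open>standard_simplex 0\<close>. Evaluating there identifies a
  singular 0-simplex with a point of the space.\<close>

abbreviation simplex_vertex :: "nat \<Rightarrow> real" where
  "simplex_vertex \<equiv> \<lambda>j. if j = 0 then 1 else 0"

text \<open>For \<open>A\<close> a union of path components, \<open>weight_on A\<close> descends to a functional on \<open>H\<^sub>0\<close>.\<close>

definition weight_on :: "'a set \<Rightarrow> ('a, 'f::field) fchain \<Rightarrow> 'f" where
  "weight_on A c = (\<Sum>\<sigma>\<in>Poly_Mapping.keys c. if \<sigma> simplex_vertex \<in> A then Poly_Mapping.lookup c \<sigma> else 0)"

lemma weight_on_superset:
  assumes "finite S" "Poly_Mapping.keys c \<subseteq> S"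
  shows "weight_on A c = (\<Sum>\<sigma>\<in>S. if \<sigma> simplex_vertex \<in> A then Poly_Mapping.lookup c \<sigma> else 0)"
  unfolding weight_on_def using assms
  by (auto intro!: sum.mono_neutral_left simp: in_keys_iff)

lemma weight_on_0 [simp]: "weight_on A 0 = 0"
  by (simp add: weight_on_def)

lemma weight_on_add: "weight_on A (c + d) = weight_on A c + weight_on A d"
proof -
  define S where "S = Poly_Mapping.keys c \<union> Poly_Mapping.keys d"
  have S: "finite S" "Poly_Mapping.keys c \<subseteq> S" "Poly_Mapping.keys d \<subseteq> S"
    "Poly_Mapping.keys (c + d) \<subseteq> S"
    unfolding S_def using Poly_Mapping.keys_add[of c d] by auto
  show ?thesis
    unfolding weight_on_superset[OF S(1,2)] weight_on_superset[OF S(1,3)]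
      weight_on_superset[OF S(1,4)]
    unfolding sum.distrib[symmetric] by (rule sum.cong) (simp_all add: lookup_add)
qed

lemma weight_on_scale: "weight_on A (fscale a c) = a * weight_on A c"
  unfolding weight_on_superset[OF finite_keys keys_fscale[of a c]]
    weight_on_superset[OF finite_keys[of c] order_refl]
  by (simp add: sum_distrib_left) (rule sum.cong; simp)

lemma weight_on_diff: "weight_on A (c - d) = weight_on A c - weight_on A d"
  using weight_on_add[of A "c - d" d] by simp

lemma weight_on_sum: "weight_on A (\<Sum>i\<in>I. f i) = (\<Sum>i\<in>I. weight_on A (f i))"
  by (induction I rule: infinite_finite_induct) (simp_all add: weight_on_add)

lemma weight_on_single:
  "weight_on A (Poly_Mapping.single \<sigma> x) = (if \<sigma> simplex_vertex \<in> A then x else 0)"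
  by (simp add: weight_on_def)

lemma fcycles_0: "fcycles 0 X = fchains 0 X"
  by (simp add: fcycles_def fboundary_def)

text \<open>Singular simplices are extensional and \<open>standard_simplex 0\<close> is a single
  point, so one value determines them.\<close>

lemma singular_simplex_0_eq_iff:
  assumes "singular_simplex 0 X \<sigma>" "singular_simplex 0 X \<tau>"
  shows "\<sigma> = \<tau> \<longleftrightarrow> \<sigma> simplex_vertex = \<tau> simplex_vertex"
  using assms extensionalityI[of \<sigma> "standard_simplex 0" \<tau>]
  by (auto simp: singular_simplex_def standard_simplex_0)

lemma simplical_face_Suc_0_simplex_vertex:
  "simplical_face 0 simplex_vertex = (\<lambda>i. if i = 1 then 1 else (0::real))"
  "simplical_face (Suc 0) simplex_vertex = simplex_vertex"
  by (auto simp: simplical_face_def fun_eq_iff)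

lemma fboundary_1_single:
  "fboundary (Suc 0) (Poly_Mapping.single \<tau> (1::'f::field)) =
     Poly_Mapping.single (singular_face (Suc 0) 0 \<tau>) 1 -
     Poly_Mapping.single (singular_face (Suc 0) (Suc 0) \<tau>) 1"
  by (simp add: fboundary_def flip: single_uminus)

text \<open>A path in \<open>C\<close> from the point of \<open>\<tau>\<close> to that of
  \<open>\<sigma>\<close>, read as a 1-simplex, has this difference as its boundary.\<close>

lemma ends_difference_in_fboundaries:
  assumes X: "path_connectedin X C" and \<sigma>: "singular_simplex 0 X \<sigma>" "\<sigma> simplex_vertex \<in> C"
    and \<tau>: "singular_simplex 0 X \<tau>" "\<tau> simplex_vertex \<in> C"
  shows "Poly_Mapping.single \<sigma> (1::'f::field) - Poly_Mapping.single \<tau> 1 \<in> fboundaries 0 X"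
proof -
  obtain g where g: "pathin (subtopology X C) g" "g 1 = \<sigma> simplex_vertex" "g 0 = \<tau> simplex_vertex"
  proof -
    have "\<forall>x\<in>C. \<forall>y\<in>C. \<exists>g. pathin (subtopology X C) g \<and> g 0 = x \<and> g 1 = y"
      using X unfolding path_connectedin_def path_connected_space_def by (auto simp: inf.absorb2)
    from bspec[OF bspec[OF this \<tau>(2)] \<sigma>(2)] that show thesis by auto
  qed
  \<comment> \<open>The coordinate \<open>x 1\<close> identifies the standard 1-simplex with the
    unit interval. Face 0 omits vertex 0 and hence is the end \<open>g 1\<close>; face 1 is the
    start \<open>g 0\<close>. The restriction provides extensionality.\<close>
  define p where "p = restrict (g \<circ> (\<lambda>x. x 1)) (standard_simplex (Suc 0))"
  have gX: "continuous_map (top_of_set {0..1}) X g"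
    using g(1) by (simp add: pathin_def continuous_map_in_subtopology)
  have "continuous_map (subtopology (powertop_real UNIV) (standard_simplex (Suc 0)))
       (top_of_set {0..1}) (\<lambda>x. x 1)"
    by (auto simp: continuous_map_in_subtopology standard_simplex_def
        intro!: continuous_map_from_subtopology continuous_map_product_projection)
  then have "continuous_map (subtopology (powertop_real UNIV) (standard_simplex (Suc 0))) X (g \<circ> (\<lambda>x. x 1))"
    using gX by (rule continuous_map_compose)
  then have p: "singular_simplex (Suc 0) X p"
    unfolding singular_simplex_def p_def by auto
  have "singular_simplex 0 X (singular_face (Suc 0) k p)" if "k \<le> 1" for k
    using singular_simplex_singular_face[OF p, of k] that by simp
  moreover have "singular_face (Suc 0) 0 p simplex_vertex = \<sigma> simplex_vertex"
    "singular_face (Suc 0) (Suc 0) p simplex_vertex = \<tau> simplex_vertex"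
    using g(2,3) by (simp_all add: singular_face_def p_def simplical_face_Suc_0_simplex_vertex)
  ultimately have "singular_face (Suc 0) 0 p = \<sigma>" "singular_face (Suc 0) (Suc 0) p = \<tau>"
    using \<sigma>(1) \<tau>(1) by (simp_all add: singular_simplex_0_eq_iff[of X])
  then have "fboundary (Suc 0) (Poly_Mapping.single p (1::'f)) =
      Poly_Mapping.single \<sigma> 1 - Poly_Mapping.single \<tau> 1"
    by (simp add: fboundary_1_single)
  moreover have "Poly_Mapping.single p (1::'f) \<in> fchains (Suc 0) X"
    using p by (simp add: fchains_def)
  ultimately show ?thesis
    unfolding fboundaries_def by (metis imageI)
qed

text \<open>The image of a 1-simplex is connected, so it lies inside the clopen part
  \<open>C\<close> or misses it. Either way its two ends contribute opposite weights.\<close>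

lemma weight_on_fboundary:
  assumes c: "c \<in> fchains (Suc 0) X"
    and C: "openin X (topspace X \<inter> C)" "openin X (topspace X - C)"
  shows "weight_on C (fboundary (Suc 0) c) = 0"
proof -
  have "weight_on C (fboundary (Suc 0) c) =
    (\<Sum>\<tau>\<in>Poly_Mapping.keys c.
       (if singular_face (Suc 0) 0 \<tau> simplex_vertex \<in> C then Poly_Mapping.lookup c \<tau> else 0) -
       (if singular_face (Suc 0) (Suc 0) \<tau> simplex_vertex \<in> C then Poly_Mapping.lookup c \<tau> else 0))"
    by (simp add: fboundary_def weight_on_sum weight_on_add weight_on_single) (rule sum.cong; simp)
  also have "\<dots> = 0"
  proof (rule sum.neutral, rule ballI)
    fix \<tau> assume "\<tau> \<in> Poly_Mapping.keys c"
    then have \<tau>: "singular_simplex (Suc 0) X \<tau>"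
      using c by (auto simp: fchains_def)
    have "continuous_map (subtopology (powertop_real UNIV) (standard_simplex (Suc 0))) X \<tau>"
      using \<tau> by (simp add: singular_simplex_def)
    then have S: "connectedin X (\<tau> ` standard_simplex (Suc 0))"
      by (rule connectedin_continuous_map_image) (simp add: connectedin_subtopology connectedin_standard_simplex)
    have sub: "\<tau> ` standard_simplex (Suc 0) \<subseteq> topspace X"
      using S connectedin_subset_topspace by blast
    define S where "S = \<tau> ` standard_simplex (Suc 0)"
    have "\<not> (S \<subseteq> (topspace X \<inter> C) \<union> (topspace X - C) \<and> (topspace X \<inter> C) \<inter> (topspace X - C) \<inter> S = {} \<and>
        (topspace X \<inter> C) \<inter> S \<noteq> {} \<and> (topspace X - C) \<inter> S \<noteq> {})"
      using S C unfolding connectedin S_def[symmetric] by blast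
    then have "\<tau> ` standard_simplex (Suc 0) \<subseteq> C \<or> \<tau> ` standard_simplex (Suc 0) \<inter> C = {}"
      using sub unfolding S_def[symmetric] by blast
    moreover have "singular_face (Suc 0) k \<tau> simplex_vertex \<in> \<tau> ` standard_simplex (Suc 0)"
      if "k \<le> 1" for k
      using that simplical_face_in_standard_simplex[of "Suc 0" k simplex_vertex]
      by (auto simp: singular_face_def)
    then have "singular_face (Suc 0) 0 \<tau> simplex_vertex \<in> \<tau> ` standard_simplex (Suc 0)"
      "singular_face (Suc 0) (Suc 0) \<tau> simplex_vertex \<in> \<tau> ` standard_simplex (Suc 0)" by simp_all
    ultimately show "(if singular_face (Suc 0) 0 \<tau> simplex_vertex \<in> C then Poly_Mapping.lookup c \<tau> else 0) -
       (if singular_face (Suc 0) (Suc 0) \<tau> simplex_vertex \<in> C then Poly_Mapping.lookup c \<tau> else 0) = 0"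
      by (auto simp: disjoint_iff)
  qed
  finally show ?thesis .
qed

lemma fsubspace_sum:
  assumes "fsubspace B" "\<And>i. i \<in> I \<Longrightarrow> f i \<in> B"
  shows "(\<Sum>i\<in>I. f i) \<in> B"
  using assms(2) by (induction I rule: infinite_finite_induct) (use assms(1) in \<open>auto simp: fsubspace_def\<close>)

lemma single_sum:
  "Poly_Mapping.single k (\<Sum>i\<in>I. f i) = (\<Sum>i\<in>I. Poly_Mapping.single k (f i))"
  by (induction I rule: infinite_finite_induct) (simp_all add: single_add)

lemma poly_mapping_eq_sum_fscale:
  "c = (\<Sum>\<sigma>\<in>Poly_Mapping.keys c. fscale (Poly_Mapping.lookup c \<sigma>) (Poly_Mapping.single \<sigma> 1))"
  by (rule poly_mapping_eqI) (simp add: fscale_single lookup_sum lookup_single when_def in_keys_iff)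

text \<open>Weights vanish on boundaries. Conversely, move every simplex of \<open>c\<close> to one
  base simplex of its part: the differences are boundaries, and what is left is each base simplex
  times the weight of its part, which is zero. With \<open>C\<close> the whole type this covers the
  path-connected case.\<close>

lemma fboundaries_0:
  assumes C: "openin X (topspace X \<inter> C)" "openin X (topspace X - C)"
    and pc: "path_connectedin X (topspace X \<inter> C)" "path_connectedin X (topspace X - C)"
  shows "fboundaries 0 X = {c \<in> fchains 0 X. weight_on UNIV c = 0 \<and> weight_on C c = (0::'f::field)}"
    (is "?L = ?R")
proof (intro equalityI subsetI)
  fix b assume "b \<in> ?L"
  then obtain c :: "('a, 'f) fchain" where c: "b = fboundary (Suc 0) c" "c \<in> fchains (Suc 0) X"
    by (auto simp: fboundaries_def)
  have "b \<in> fchains 0 X"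
  proof -
    have "Poly_Mapping.single (singular_face (Suc 0) k \<tau>) x \<in> fchains 0 X"
      if "\<tau> \<in> Poly_Mapping.keys c" "k \<le> Suc 0" for k \<tau> and x :: 'f
      using singular_simplex_singular_face[of "Suc 0" X \<tau> k] that c(2) by (auto simp: fchains_def)
    then show ?thesis
      unfolding c(1) fboundary_def
      by (auto intro!: fsubspace_sum fsubspace_fchains simp del: sum.atMost_Suc)
  qed
  with c C weight_on_fboundary[OF c(2), of C] weight_on_fboundary[OF c(2), of UNIV]
  show "b \<in> ?R" by simp
next
  fix c assume "c \<in> ?R"
  then have c: "c \<in> fchains 0 X" and w: "weight_on UNIV c = 0" "weight_on C c = 0" by auto
  have w': "weight_on (- C) c = 0"
  proof -
    have "weight_on UNIV c = weight_on C c + weight_on (- C) c"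
      by (simp add: weight_on_def flip: sum.distrib) (rule sum.cong; simp)
    then show ?thesis using w by simp
  qed
  \<comment> \<open>The choice depends on \<open>\<sigma>\<close> only through the part containing
    its vertex, so \<open>base\<close> is constant on each part. For \<open>\<sigma>\<close> in the
    support of \<open>c\<close>, \<open>\<sigma>\<close> itself is a candidate.\<close>
  define base where "base \<sigma> = (SOME \<tau>. \<tau> \<in> Poly_Mapping.keys c \<and> (\<tau> simplex_vertex \<in> C \<longleftrightarrow> \<sigma> simplex_vertex \<in> C))"
    for \<sigma> :: "(nat \<Rightarrow> real) \<Rightarrow> 'a"
  let ?s = "\<lambda>\<sigma>. Poly_Mapping.single \<sigma> (1::'f)" and ?l = "Poly_Mapping.lookup c"
  have base: "base \<sigma> \<in> Poly_Mapping.keys c" "base \<sigma> simplex_vertex \<in> C \<longleftrightarrow> \<sigma> simplex_vertex \<in> C"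
    if "\<sigma> \<in> Poly_Mapping.keys c" for \<sigma>
    using someI[of "\<lambda>\<tau>. \<tau> \<in> Poly_Mapping.keys c \<and> (\<tau> simplex_vertex \<in> C \<longleftrightarrow> \<sigma> simplex_vertex \<in> C)" \<sigma>] that
    unfolding base_def by auto
  have *: "?s \<sigma> - ?s (base \<sigma>) \<in> fboundaries 0 X" if "\<sigma> \<in> Poly_Mapping.keys c" for \<sigma>
  proof -
    have s: "singular_simplex 0 X \<tau>" "\<tau> simplex_vertex \<in> topspace X" if "\<tau> \<in> Poly_Mapping.keys c" for \<tau>
      using c that by (auto simp: fchains_def singular_simplex_def continuous_map standard_simplex_0)
    show ?thesis
      using ends_difference_in_fboundaries[OF pc(1), of \<sigma> "base \<sigma>"] s[OF that] s[OF base(1)[OF that]]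
        ends_difference_in_fboundaries[OF pc(2), of \<sigma> "base \<sigma>"] base(2)[OF that]
      by (cases "\<sigma> simplex_vertex \<in> C") auto
  qed
  have 0: "(\<Sum>\<sigma>\<in>Poly_Mapping.keys c. fscale (?l \<sigma>) (?s (base \<sigma>))) = 0"
  proof -
    \<comment> \<open>If no simplex of \<open>c\<close> lies in a part, its base simplex is
      arbitrary; this does no harm, because its coefficient is then zero.\<close>
    have const: "\<exists>b. \<forall>\<sigma>. (\<sigma> simplex_vertex \<in> C \<longleftrightarrow> P) \<longrightarrow> base \<sigma> = b" for P
      by (auto simp: base_def)
    obtain b where b: "\<And>\<sigma>. \<sigma> simplex_vertex \<in> C \<Longrightarrow> base \<sigma> = b"
      using const[of True] by auto
    obtain b' where b': "\<And>\<sigma>. \<sigma> simplex_vertex \<notin> C \<Longrightarrow> base \<sigma> = b'"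
      using const[of False] by auto
    have "(\<Sum>\<sigma>\<in>Poly_Mapping.keys c. fscale (?l \<sigma>) (?s (base \<sigma>))) =
      (\<Sum>\<sigma>\<in>Poly_Mapping.keys c. Poly_Mapping.single b (if \<sigma> simplex_vertex \<in> C then ?l \<sigma> else 0) +
        Poly_Mapping.single b' (if \<sigma> simplex_vertex \<in> - C then ?l \<sigma> else 0))"
      by (rule sum.cong) (auto simp: fscale_single b b')
    also have "\<dots> = Poly_Mapping.single b (weight_on C c) + Poly_Mapping.single b' (weight_on (- C) c)"
      by (simp add: sum.distrib weight_on_def single_sum)
    finally show ?thesis using w(2) w' by simp
  qed
  have "c = (\<Sum>\<sigma>\<in>Poly_Mapping.keys c. fscale (?l \<sigma>) (?s \<sigma> - ?s (base \<sigma>))) +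
      (\<Sum>\<sigma>\<in>Poly_Mapping.keys c. fscale (?l \<sigma>) (?s (base \<sigma>)))"
    unfolding sum.distrib[symmetric] fscale_simps(1)[symmetric] diff_add_cancel
    by (rule poly_mapping_eq_sum_fscale)
  then have "c = (\<Sum>\<sigma>\<in>Poly_Mapping.keys c. fscale (?l \<sigma>) (?s \<sigma> - ?s (base \<sigma>)))"
    by (simp add: 0)
  also have "\<dots> \<in> fboundaries 0 X"
    using * fsubspace_fboundaries[of 0 X] by (intro fsubspace_sum) (auto simp: fsubspace_def)
  finally show "c \<in> ?L" .
qed

section \<open>Identification of an induced module with a two-bar module\<close>

definition point_simplex :: "'a \<Rightarrow> (nat \<Rightarrow> real) \<Rightarrow> 'a" where
  "point_simplex p = restrict (\<lambda>_. p) (standard_simplex 0)"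

lemma single_point_simplex_in_fchains:
  "p \<in> topspace X \<Longrightarrow> Poly_Mapping.single (point_simplex p) x \<in> fchains 0 X"
  by (auto simp: fchains_def singular_simplex_def point_simplex_def)

lemma point_simplex_vertex [simp]: "point_simplex p simplex_vertex = p"
  by (simp add: point_simplex_def)

lemma coset_eqI:
  assumes "fsubspace B" "z - w \<in> B"
  shows "(+) z ` B = (+) w ` B"
proof -
  have "(+) z ` B \<subseteq> (+) w ` B" if "z - w \<in> B" for z w
  proof
    fix x assume "x \<in> (+) z ` B"
    then obtain b where "b \<in> B" "x = z + b" by auto
    then have "x = w + ((z - w) + b)" "(z - w) + b \<in> B"
      using assms(1) that by (auto simp: fsubspace_def)
    then show "x \<in> (+) w ` B" by blast
  qed
  moreover have "w - z \<in> B"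
    using fsubspace_uminus[OF assms] by simp
  ultimately show ?thesis using assms(2) by blast
qed

text \<open>Total weight and weight on \<open>C\<close> serve as coordinates on degree-zero
  homology. One set \<open>C\<close> separates all levels up to \<open>T\<close>, so both
  coordinates commute with inclusions: the first gives the infinite bar, the second the bar ending
  at \<open>T\<close>.\<close>

lemma induced_pmodule_isomorphic_two_bar:
  fixes u :: "complex \<Rightarrow> complex" and C :: "complex set"
  assumes sep: "\<And>t. 0 < t \<Longrightarrow> t \<le> T \<Longrightarrow>
       openin (top_of_set (sublevel u t)) (sublevel u t \<inter> C) \<and>
       openin (top_of_set (sublevel u t)) (sublevel u t - C) \<and>
       path_connected (sublevel u t \<inter> C) \<and> path_connected (sublevel u t - C) \<and>
       sublevel u t \<inter> C \<noteq> {} \<and> sublevel u t - C \<noteq> {}"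
    and conn: "\<And>t. 0 < t \<Longrightarrow> T < t \<Longrightarrow> path_connected (sublevel u t) \<and> sublevel u t \<noteq> {}"
  shows "pm_isomorphic (induced_pmodule u :: ('f::field, (complex, 'f) fchain set) pmodule)
           (two_bar_module T)"
proof -
  let ?V = "induced_pmodule u :: ('f, (complex, 'f) fchain set) pmodule"
  let ?W = "two_bar_module T :: ('f, 'f \<times> 'f) pmodule"
  let ?X = "\<lambda>t. top_of_set (sublevel u t)"
  define Z :: "real \<Rightarrow> (complex, 'f) fchain set" where "Z t = fchains 0 (?X t)" for t
  define B :: "real \<Rightarrow> (complex, 'f) fchain set" where "B t = fboundaries 0 (?X t)" for t
  define e where "e t z = (weight_on UNIV z, if t \<le> T then weight_on C z else 0)"
    for t and z :: "(complex, 'f) fchain"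
  have Zs: "fsubspace (Z t)" and Bs: "fsubspace (B t)" for t
    by (simp_all add: Z_def B_def fsubspace_fchains fsubspace_fboundaries)
  have Zmono: "Z s \<subseteq> Z t" and Bmono: "B s \<subseteq> B t" if "s \<le> t" for s t
    using that fcycles_mono[OF sublevel_mono[OF that, of u], of 0]
    by (simp_all add: Z_def B_def fcycles_0 fboundaries_mono sublevel_mono)
  have e_add: "e t (z + w) = e t z + e t w" and e_diff: "e t (z - w) = e t z - e t w"
    and e_scale: "e t (fscale a z) = (a * fst (e t z), a * snd (e t z))" for t z w a
    by (simp_all add: e_def weight_on_add weight_on_diff weight_on_scale)
  have B_eq: "B t = {z \<in> Z t. e t z = 0}" if "0 < t" for t
  proof (cases "t \<le> T")
    case True
    with sep[OF that True] show ?thesis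
      using fboundaries_0[of "?X t" C]
      by (simp add: B_def Z_def e_def path_connectedin_subtopology zero_prod_def)
  next
    case False
    with conn[OF that] show ?thesis
      \<comment> \<open>With everything on one side the complement is empty and the second weight
        repeats the first, matching the zero second coordinate of \<open>e\<close> beyond
        \<open>T\<close>.\<close>
      using fboundaries_0[of "?X t" UNIV]
      by (simp add: B_def Z_def e_def path_connectedin_subtopology zero_prod_def)
  qed
  have pos: "space ?V t = quotient_space (Z t) (B t)" if "t > 0" for t
    using that by (simp add: induced_pmodule_def induced_space_def homology_space_def Z_def B_def fcycles_0)
  have neg: "space ?V t = zero_space {0}" if "t \<le> 0" for t
    using that by (simp add: induced_pmodule_def induced_space_def)
  have car: "carrier (space ?V t) = (\<lambda>z. (+) z ` B t) ` Z t" if "t > 0" for t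
    using that by (simp add: pos quotient_space_def)
  have map_pos: "smap ?V s t ((+) z ` B s) = (+) z ` B t" if "s > 0" "s \<le> t" for s t z
    using coset_add[OF Bs Bs Bmono[OF that(2)], of z 0] that
    by (simp add: induced_pmodule_def homology_inclusion_def flip: B_def)
  \<comment> \<open>Any representative of the coset serves, because \<open>e t\<close> vanishes on
    \<open>B t\<close>. For \<open>t \<le> 0\<close> the space is trivial.\<close>
  define \<Phi> where "\<Phi> t X = (if t \<le> 0 then 0 else e t (SOME z. z \<in> X))" for t and X :: "(complex, 'f) fchain set"
  have \<Phi>_coset: "\<Phi> t ((+) z ` B t) = e t z" if "t > 0" for t z
  proof -
    have "0 \<in> B t" using Bs by (simp add: fsubspace_def)
    then have "\<exists>w. w \<in> (+) z ` B t" by blast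
    then obtain b where "b \<in> B t" "(SOME w. w \<in> (+) z ` B t) = z + b"
      by (metis (no_types, lifting) imageE someI_ex)
    then show ?thesis using that by (simp add: \<Phi>_def e_add B_eq)
  qed
  have W_car: "carrier (space ?W t) = {p. (t \<le> 0 \<longrightarrow> fst p = 0) \<and> (t \<le> 0 \<or> T < t \<longrightarrow> snd p = 0)}" for t
    by (simp add: two_bar_module_def)
  have bij: "bij_betw (\<Phi> t) (carrier (space ?V t)) (carrier (space ?W t))" for t
  proof (cases "t > 0")
    case True
    have "inj_on (\<Phi> t) (carrier (space ?V t))"
    proof (rule inj_onI)
      fix X Y assume XY: "X \<in> carrier (space ?V t)" "Y \<in> carrier (space ?V t)" "\<Phi> t X = \<Phi> t Y"
      obtain z w where zw: "z \<in> Z t" "w \<in> Z t" "X = (+) z ` B t" "Y = (+) w ` B t"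
        using XY(1,2) unfolding car[OF True] by (elim imageE)
      have "e t (z - w) = 0" using XY(3) True by (simp add: zw(3,4) \<Phi>_coset e_diff)
      moreover have "z - w \<in> Z t"
      proof -
        have "z + (- w) \<in> Z t"
          using zw Zs fsubspace_uminus[OF Zs zw(2)] unfolding fsubspace_def by blast
        then show ?thesis by simp
      qed
      ultimately show "X = Y"
        unfolding zw using True by (intro coset_eqI Bs) (simp add: B_eq)
    qed
    moreover have "\<Phi> t ` carrier (space ?V t) = carrier (space ?W t)"
    proof (intro equalityI subsetI)
      fix y assume "y \<in> \<Phi> t ` carrier (space ?V t)"
      then obtain z where "y = e t z"
        unfolding car[OF True] by (elim imageE) (simp add: \<Phi>_coset[OF True])
      then show "y \<in> carrier (space ?W t)" using True by (auto simp: W_car e_def)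
    next
      fix y assume y: "y \<in> carrier (space ?W t)"
      let ?s = "\<lambda>p x. Poly_Mapping.single (point_simplex p) x :: (complex, 'f) fchain"
      have sZ: "?s p x \<in> Z t" if "p \<in> sublevel u t" for p x
        using that by (simp add: Z_def single_point_simplex_in_fchains)
      have "\<exists>z\<in>Z t. e t z = y"
      proof (cases "t \<le> T")
        case tT: True
        \<comment> \<open>One point in each part: weight \<open>snd y\<close> at \<open>p\<close>
          fixes the weight on \<open>C\<close>, and the remainder at \<open>q\<close> corrects the
          total to \<open>fst y\<close>.\<close>
        obtain p q where "p \<in> sublevel u t" "p \<in> C" "q \<in> sublevel u t" "q \<notin> C"
          using sep[OF True tT] by blast
        then show ?thesis
          using sZ[of p "snd y"] sZ[of q "fst y - snd y"] Zs[of t] tT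
          by (intro bexI[of _ "?s p (snd y) + ?s q (fst y - snd y)"])
            (auto simp: e_def weight_on_add weight_on_single fsubspace_def)
      next
        case False
        then obtain p where "p \<in> sublevel u t" using conn[OF True] by auto
        then show ?thesis
          using sZ[of p "fst y"] False y True
          by (intro bexI[of _ "?s p (fst y)"]) (auto simp: e_def weight_on_single W_car prod_eq_iff)
      qed
      then obtain z where "z \<in> Z t" "e t z = y" by blast
      then have "y = \<Phi> t ((+) z ` B t)" using \<Phi>_coset[OF True] by simp
      moreover have "(+) z ` B t \<in> carrier (space ?V t)"
        unfolding car[OF True] using \<open>z \<in> Z t\<close> by (rule imageI)
      ultimately show "y \<in> \<Phi> t ` carrier (space ?V t)" by (rule image_eqI)
    qed
    ultimately show ?thesis by (simp add: bij_betw_def)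
  next
    case False
    then have "carrier (space ?W t) = {0}" by (auto simp: W_car prod_eq_iff)
    with False show ?thesis by (auto simp: neg zero_space_def bij_betw_def \<Phi>_def)
  qed
  have lin: "linear_on (space ?V t) (space ?W t) (\<Phi> t)" for t
  proof (cases "t > 0")
    case True
    have add: "(+) z ` B t \<oplus>\<^bsub>space ?V t\<^esub> (+) w ` B t = (+) (z + w) ` B t" for z w
      using coset_add[OF Bs[of t] Bs order_refl, of z w] True by (simp add: pos quotient_space_def)
    have smult: "a \<odot>\<^bsub>space ?V t\<^esub> (+) z ` B t = (+) (fscale a z) ` B t" for a z
      using coset_smult[OF Bs[of t], of a z] True by (simp add: pos quotient_space_def)
    show ?thesis
      unfolding linear_on_def
    proof (intro conjI ballI allI)
      show "\<Phi> t \<in> carrier (space ?V t) \<rightarrow> carrier (space ?W t)"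
        by (rule bij_betw_imp_funcset[OF bij])
    next
      fix X Y assume "X \<in> carrier (space ?V t)" "Y \<in> carrier (space ?V t)"
      then obtain z w where "X = (+) z ` B t" "Y = (+) w ` B t"
        unfolding car[OF True] by (elim imageE)
      then show "\<Phi> t (X \<oplus>\<^bsub>space ?V t\<^esub> Y) = \<Phi> t X \<oplus>\<^bsub>space ?W t\<^esub> \<Phi> t Y"
        by (simp only: add \<Phi>_coset[OF True] e_add) (simp add: two_bar_module_def)
    next
      fix a X assume "X \<in> carrier (space ?V t)"
      then obtain z where "X = (+) z ` B t"
        unfolding car[OF True] by (elim imageE)
      then show "\<Phi> t (a \<odot>\<^bsub>space ?V t\<^esub> X) = a \<odot>\<^bsub>space ?W t\<^esub> \<Phi> t X"
        by (simp only: smult \<Phi>_coset[OF True] e_scale) (simp add: two_bar_module_def)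
    qed
  next
    case False
    then show ?thesis
      using bij_betw_imp_funcset[OF bij[of t]] unfolding linear_on_def
      by (auto simp: neg \<Phi>_def two_bar_module_def zero_prod_def)
  qed
  have comm: "\<Phi> t (smap ?V s t X) = smap ?W s t (\<Phi> s X)"
    if st: "s \<le> t" and X: "X \<in> carrier (space ?V s)" for s t X
  proof (cases "s > 0")
    case True
    then obtain z where "X = (+) z ` B s" using X unfolding car[OF True] by blast
    then show ?thesis
      using True st by (simp add: map_pos \<Phi>_coset) (simp add: e_def two_bar_module_def)
  next
    case False
    \<comment> \<open>From a time \<open>s \<le> 0\<close> the structure map always returns the zero
      of its target.\<close>
    have "\<Phi> t (\<zero>\<^bsub>space ?V t\<^esub>) = 0"
    proof (cases "t > 0")
      case True
      have "\<zero>\<^bsub>space ?V t\<^esub> = (+) 0 ` B t" using True by (simp add: pos quotient_space_def)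
      then show ?thesis using \<Phi>_coset[OF True, of 0] by (simp add: e_def zero_prod_def)
    qed (simp add: \<Phi>_def)
    with False show ?thesis
      by (simp add: induced_pmodule_def \<Phi>_def two_bar_module_def zero_prod_def)
  qed
  have "pm_morphism ?V ?W \<Phi>"
    unfolding pm_morphism_def using lin comm by blast
  from pm_isomorphicI[OF persistence_module_induced this bij] show ?thesis .
qed

section \<open>Sublevel sets of Blaschke products with two zeros\<close>

text \<open>
  The automorphism of the disc exchanging \<open>m\<close> and \<open>0\<close>; the number \<open>cmod (disc_involution m z)\<close>
  is the pseudo-hyperbolic distance of \<open>m\<close> and \<open>z\<close>.
\<close>

definition disc_involution :: "complex \<Rightarrow> complex \<Rightarrow> complex" where
  "disc_involution m z = (m - z) / (1 - cnj m * z)"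

lemma one_minus_cnj_mult_nonzero:
  assumes "cmod m < 1" "cmod z < 1"
  shows "1 - cnj m * z \<noteq> 0"
proof
  assume "1 - cnj m * z = 0"
  then have "cmod m * cmod z = 1" by (metis complex_mod_cnj eq_iff_diff_eq_0 norm_mult norm_one)
  moreover have "cmod m * cmod z < 1 * 1"
    using assms by (intro mult_strict_mono') auto
  ultimately show False by simp
qed

lemma cmod_diff_squared: "(cmod (x - y))\<^sup>2 = (cmod x)\<^sup>2 - 2 * Re (cnj x * y) + (cmod y)\<^sup>2"
  by (simp add: cmod_power2) (simp add: power2_eq_square algebra_simps)

lemma cmod_disc_involution_less_1:
  assumes "cmod m < 1" "cmod z < 1"
  shows "cmod (disc_involution m z) < 1"
proof -
  have "(cmod (1 - cnj m * z))\<^sup>2 - (cmod (m - z))\<^sup>2 = (1 - (cmod m)\<^sup>2) * (1 - (cmod z)\<^sup>2)"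
    by (simp add: cmod_diff_squared norm_mult power_mult_distrib) (simp add: algebra_simps)
  moreover have "0 < (1 - (cmod m)\<^sup>2) * (1 - (cmod z)\<^sup>2)"
    using assms by (intro mult_pos_pos) (auto simp: power_less_one_iff abs_square_less_1)
  ultimately have "(cmod (m - z))\<^sup>2 < (cmod (1 - cnj m * z))\<^sup>2" by linarith
  then have "cmod (m - z) < cmod (1 - cnj m * z)"
    by (rule power2_less_imp_less) simp
  then show ?thesis
    using one_minus_cnj_mult_nonzero[OF assms] by (simp add: disc_involution_def norm_divide)
qed

lemma disc_involution_idem:
  assumes "cmod m < 1" "cmod z < 1"
  shows "disc_involution m (disc_involution m z) = z"
proof -
  have nz: "1 - cnj m * z \<noteq> 0" "1 - cnj m * m \<noteq> 0"
    using one_minus_cnj_mult_nonzero assms by auto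
  have "m - disc_involution m z = z * (1 - cnj m * m) / (1 - cnj m * z)"
    unfolding disc_involution_def using nz by (simp add: field_simps)
  moreover have "1 - cnj m * disc_involution m z = (1 - cnj m * m) / (1 - cnj m * z)"
    unfolding disc_involution_def using nz by (simp add: field_simps)
  ultimately show ?thesis
    using nz unfolding disc_involution_def[of m "disc_involution m z"] by simp
qed

lemma continuous_on_disc_involution:
  assumes "cmod m < 1" "continuous_on S f" "\<And>x. x \<in> S \<Longrightarrow> cmod (f x) < 1"
  shows "continuous_on S (\<lambda>x. disc_involution m (f x))"
  unfolding disc_involution_def
  using assms one_minus_cnj_mult_nonzero[OF assms(1)] by (intro continuous_intros) auto

text \<open>Numerator and denominator both acquire the factor \<open>1 - cnj m * m\<close>, which
  cancels; the other new factors agree up to conjugation, which the modulus ignores.\<close>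

lemma cmod_disc_involution_invariant:
  assumes "cmod m < 1" "cmod z < 1" "cmod w < 1"
  shows "cmod (disc_involution (disc_involution m w) (disc_involution m z)) = cmod (disc_involution w z)"
proof -
  have nz: "1 - cnj m * z \<noteq> 0" "1 - cnj m * w \<noteq> 0" "1 - m * cnj w \<noteq> 0" "1 - cnj w * z \<noteq> 0" "1 - cnj m * m \<noteq> 0"
    using one_minus_cnj_mult_nonzero assms
    by (auto simp: one_minus_cnj_mult_nonzero mult.commute[of m])
  have 1: "disc_involution m w - disc_involution m z = (z - w) * (1 - cnj m * m) / ((1 - cnj m * z) * (1 - cnj m * w))"
    unfolding disc_involution_def using nz by (simp add: divide_simps) (simp add: algebra_simps)
  have 2: "1 - cnj (disc_involution m w) * disc_involution m z =
      (1 - cnj w * z) * (1 - cnj m * m) / ((1 - cnj m * z) * (1 - m * cnj w))"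
    unfolding disc_involution_def using nz by (simp add: divide_simps) (simp add: algebra_simps)
  have "cmod (1 - m * cnj w) = cmod (1 - cnj m * w)"
    by (metis complex_cnj_cnj complex_cnj_diff complex_cnj_mult complex_cnj_one complex_mod_cnj)
  moreover have "cmod (1 - m * cnj w) \<noteq> 0" "cmod (1 - cnj m * z) \<noteq> 0" "cmod (1 - cnj m * m) \<noteq> 0"
    using nz by simp_all
  ultimately show ?thesis
    unfolding disc_involution_def[of "disc_involution m w"] 1 2
    by (simp add: norm_divide norm_mult disc_involution_def[of w] norm_minus_commute[of z])
qed

text \<open>Either empty or a ball. Including \<open>r \<le> 0\<close> makes the result applicable
  to a completed square without a sign check on \<open>r\<close>.\<close>

lemma convex_norm_diff_squared_less: "convex {v :: 'a::euclidean_space. (norm (v - c))\<^sup>2 < r}"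
proof (cases "r \<le> 0")
  case True
  then have "{v. (norm (v - c))\<^sup>2 < r} = {}"
    by (auto simp: not_less intro: order_trans[OF True])
  then show ?thesis by simp
next
  case False
  then have "(norm (v - c))\<^sup>2 < r \<longleftrightarrow> norm (c - v) < sqrt r" for v
    using real_sqrt_less_iff[of "(norm (v - c))\<^sup>2" r] by (simp add: norm_minus_commute)
  then have "{v. (norm (v - c))\<^sup>2 < r} = ball c (sqrt r)"
    by (simp only: ball_def dist_norm)
  then show ?thesis by (simp only: convex_ball)
qed

text \<open>Pseudo-hyperbolic discs are Euclidean discs.\<close>

lemma convex_pseudohyperbolic_disc:
  assumes b: "cmod b < 1" and \<theta>: "0 < \<theta>" "\<theta> < 1"
  shows "convex {v \<in> ball 0 1. cmod (disc_involution b v) < \<theta>}"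
proof -
  \<comment> \<open>These come from completing the square in \<open>v\<close>: the inequality
    becomes that of a Euclidean disc with centre \<open>\<eta> * b\<close> and squared radius
    \<open>r\<close>, after division by the positive leading coefficient
    \<open>\<kappa>\<close>.\<close>
  define \<kappa> where "\<kappa> = 1 - \<theta>\<^sup>2 * (cmod b)\<^sup>2"
  define \<eta> where "\<eta> = (1 - \<theta>\<^sup>2) / \<kappa>"
  define r where "r = \<eta>\<^sup>2 * (cmod b)\<^sup>2 - ((cmod b)\<^sup>2 - \<theta>\<^sup>2) / \<kappa>"
  have "\<theta>\<^sup>2 * (cmod b)\<^sup>2 < 1 * 1"
    using b \<theta> by (intro mult_strict_mono') (auto simp: power_less_one_iff abs_square_less_1)
  then have \<kappa>: "\<kappa> > 0" by (simp add: \<kappa>_def)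
  have "cmod (disc_involution b v) < \<theta> \<longleftrightarrow> (cmod (v - of_real \<eta> * b))\<^sup>2 < r" if "cmod v < 1" for v
  proof -
    have nz: "cmod (1 - cnj b * v) > 0" using one_minus_cnj_mult_nonzero[OF b that] by simp
    have "cmod (disc_involution b v) < \<theta> \<longleftrightarrow> cmod (b - v) < \<theta> * cmod (1 - cnj b * v)"
      using nz by (simp add: disc_involution_def norm_divide divide_simps)
    also have "\<dots> \<longleftrightarrow> (cmod (b - v))\<^sup>2 < (\<theta> * cmod (1 - cnj b * v))\<^sup>2"
    proof
      assume "cmod (b - v) < \<theta> * cmod (1 - cnj b * v)"
      then show "(cmod (b - v))\<^sup>2 < (\<theta> * cmod (1 - cnj b * v))\<^sup>2"
        by (rule power_strict_mono) simp_all
    next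
      assume "(cmod (b - v))\<^sup>2 < (\<theta> * cmod (1 - cnj b * v))\<^sup>2"
      then show "cmod (b - v) < \<theta> * cmod (1 - cnj b * v)"
        by (rule power2_less_imp_less) (use \<theta> in simp)
    qed
    also have "\<dots> \<longleftrightarrow> \<kappa> * (cmod v)\<^sup>2 - 2 * (1 - \<theta>\<^sup>2) * Re (cnj b * v) + ((cmod b)\<^sup>2 - \<theta>\<^sup>2) < 0"
      by (simp add: cmod_diff_squared norm_mult power_mult_distrib \<kappa>_def) (simp add: algebra_simps)
    also have "\<dots> \<longleftrightarrow> \<kappa> * ((cmod (v - of_real \<eta> * b))\<^sup>2 - r) < 0"
    proof -
      define q where "q = ((cmod b)\<^sup>2 - \<theta>\<^sup>2) / \<kappa>"
      have q: "\<kappa> * q = (cmod b)\<^sup>2 - \<theta>\<^sup>2" and \<eta>: "\<kappa> * \<eta> = 1 - \<theta>\<^sup>2"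
        using \<kappa> by (simp_all add: \<eta>_def q_def)
      have "(cmod (v - of_real \<eta> * b))\<^sup>2 = (cmod v)\<^sup>2 - 2 * \<eta> * Re (cnj b * v) + \<eta>\<^sup>2 * (cmod b)\<^sup>2"
        by (simp add: cmod_diff_squared norm_mult power_mult_distrib) (simp add: algebra_simps)
      then have "(cmod (v - of_real \<eta> * b))\<^sup>2 - r = (cmod v)\<^sup>2 - 2 * \<eta> * Re (cnj b * v) + q"
        unfolding r_def q_def by linarith
      moreover have "\<kappa> * (x - 2 * \<eta> * y + q) = \<kappa> * x - 2 * (\<kappa> * \<eta>) * y + \<kappa> * q" for x y
        by (simp add: algebra_simps)
      ultimately have "\<kappa> * ((cmod (v - of_real \<eta> * b))\<^sup>2 - r) =
          \<kappa> * (cmod v)\<^sup>2 - 2 * (\<kappa> * \<eta>) * Re (cnj b * v) + \<kappa> * q"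
        by (simp only:)
      then have "\<kappa> * ((cmod (v - of_real \<eta> * b))\<^sup>2 - r) =
          \<kappa> * (cmod v)\<^sup>2 - 2 * (1 - \<theta>\<^sup>2) * Re (cnj b * v) + ((cmod b)\<^sup>2 - \<theta>\<^sup>2)"
        by (simp only: q \<eta>)
      then show ?thesis by simp
    qed
    also have "\<dots> \<longleftrightarrow> (cmod (v - of_real \<eta> * b))\<^sup>2 < r"
      using \<kappa> by (simp add: mult_less_0_iff)
    finally show ?thesis .
  qed
  then have "{v \<in> ball 0 1. cmod (disc_involution b v) < \<theta>} =
      ball 0 1 \<inter> {v. (cmod (v - of_real \<eta> * b))\<^sup>2 < r}"
    by auto
  then show ?thesis
    by (simp add: convex_Int convex_norm_diff_squared_less)
qed

section \<open>Sublevel sets for opposite zeros\<close>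

text \<open>Both the numerators and the denominators multiply as differences of squares, so the
  product factors through squaring.\<close>

lemma cmod_disc_involution_mult_minus:
  "cmod (disc_involution a z) * cmod (disc_involution (- a) z) = cmod (disc_involution (a\<^sup>2) (z\<^sup>2))"
proof -
  have "disc_involution a z * disc_involution (- a) z = - disc_involution (a\<^sup>2) (z\<^sup>2)"
  proof -
    have "(a - z) * (- a - z) = - (a\<^sup>2 - z\<^sup>2)" "(1 - cnj a * z) * (1 - cnj (- a) * z) = 1 - cnj (a\<^sup>2) * z\<^sup>2"
      by (simp_all add: power2_eq_square algebra_simps)
    then show ?thesis
      by (simp only: disc_involution_def times_divide_times_eq minus_divide_left)
  qed
  then show ?thesis by (metis norm_minus_cancel norm_mult)
qed

lemma imaginary_square_nonpos:
  assumes "Re z = 0" shows "z\<^sup>2 \<in> \<real>\<^sub>\<le>\<^sub>0"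
proof -
  have "z\<^sup>2 = of_real (- (Im z)\<^sup>2)"
    using assms by (simp add: complex_eq_iff power2_eq_square)
  then show ?thesis by (simp only: nonpos_Reals_of_real_iff) simp
qed

lemma cmod_square_less_1: "cmod (z\<^sup>2) < 1 \<longleftrightarrow> cmod z < 1"
  by (simp add: norm_power abs_square_less_1)

context
  fixes a :: complex and \<theta> :: real
  assumes a: "cmod a < 1" and \<theta>: "0 < \<theta>" "\<theta> < 1"
begin

text \<open>\<open>D\<close> is the pseudo-hyperbolic disc around \<open>a\<^sup>2\<close>, and
  \<open>X\<close> below is its preimage under squaring.\<close>

private abbreviation "D \<equiv> {v \<in> ball 0 1. cmod (disc_involution (a\<^sup>2) v) < \<theta>}"

private abbreviation "X \<equiv> {z \<in> ball 0 1. cmod (disc_involution a z) * cmod (disc_involution (- a) z) < \<theta>}"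

private lemma mem_two_zero_sublevel_iff: "z \<in> X \<longleftrightarrow> z\<^sup>2 \<in> D"
  using cmod_square_less_1[of z] by (simp add: cmod_disc_involution_mult_minus del: norm_power)

private lemma convex_disc: "convex D"
  using convex_pseudohyperbolic_disc[of "a\<^sup>2" \<theta>] cmod_square_less_1[of a] a \<theta> by blast

text \<open>The hypothesis puts 0 into the convex set \<open>D\<close>. Squaring maps the segment
  from 0 to \<open>z\<close> into the segment from 0 to \<open>z\<^sup>2\<close>, so
  \<open>X\<close> is star-shaped about 0.\<close>

lemma path_connected_two_zero_sublevel:
  assumes "(cmod a)\<^sup>2 < \<theta>"
  shows "path_connected X"
proof -
  have 0: "0 \<in> D" using assms by (simp add: disc_involution_def norm_power)
  have "closed_segment 0 z \<subseteq> X" if z: "z \<in> X" for z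
  proof
    fix x assume "x \<in> closed_segment 0 z"
    then obtain u where u: "0 \<le> u" "u \<le> 1" "x = u *\<^sub>R z"
      by (auto simp: in_segment)
    have "x\<^sup>2 = (1 - u\<^sup>2) *\<^sub>R 0 + u\<^sup>2 *\<^sub>R z\<^sup>2"
      by (simp add: u scaleR_conv_of_real power_mult_distrib)
    moreover have "z\<^sup>2 \<in> D" using z by (simp only: mem_two_zero_sublevel_iff)
    moreover have "0 \<le> u\<^sup>2" "u\<^sup>2 \<le> 1" using u by (auto simp: power_le_one)
    ultimately have "x\<^sup>2 \<in> D"
      using convexD_alt[OF convex_disc 0, of "z\<^sup>2" "u\<^sup>2"] by (simp only:)
    then show "x \<in> X" by (simp only: mem_two_zero_sublevel_iff)
  qed
  moreover have "0 \<in> X" using 0 mem_two_zero_sublevel_iff[of 0] by simp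
  ultimately have "starlike X" unfolding starlike_def by blast
  then show ?thesis by (rule starlike_imp_path_connected)
qed

context
  assumes le: "\<theta> \<le> (cmod a)\<^sup>2"
begin

private lemma zero_nonzero: "a \<noteq> 0"
  using le \<theta> by auto

text \<open>At \<open>v = - s * a\<^sup>2\<close> with \<open>s \<ge> 0\<close> the distance from
  \<open>a\<^sup>2\<close> is \<open>(1 + s) * \<beta> / (1 + s * \<beta>\<^sup>2)\<close>, which is
  at least \<open>\<beta>\<close> as \<open>\<beta> \<le> 1\<close>. Hence \<open>D\<close> avoids a
  slit along which the square root can be cut.\<close>

private lemma disc_avoids_opposite_ray:
  assumes "v \<in> D" shows "v / a\<^sup>2 \<notin> \<real>\<^sub>\<le>\<^sub>0"
proof
  assume "v / a\<^sup>2 \<in> \<real>\<^sub>\<le>\<^sub>0"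
  then obtain x where "v / a\<^sup>2 = of_real x" "x \<le> 0"
    by (auto elim: nonpos_Reals_cases)
  then obtain s where s: "s \<ge> 0" "v = - of_real s * a\<^sup>2"
    using zero_nonzero by (intro that[of "- x"]) (auto simp: field_simps)
  define \<beta> where "\<beta> = (cmod a)\<^sup>2"
  have \<beta>: "0 \<le> \<beta>" "\<beta>\<^sup>2 \<le> 1" using a by (auto simp: \<beta>_def power_le_one)
  have "a\<^sup>2 - v = of_real (1 + s) * a\<^sup>2" by (simp add: s algebra_simps)
  then have n: "cmod (a\<^sup>2 - v) = (1 + s) * \<beta>"
    using s by (simp only: norm_mult norm_of_real) (simp add: \<beta>_def norm_power)
  have "1 - cnj (a\<^sup>2) * v = of_real (1 + s * \<beta>\<^sup>2)"
  proof -
    have "cnj (a\<^sup>2) * a\<^sup>2 = of_real (\<beta>\<^sup>2)"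
    proof -
      have "cnj (a\<^sup>2) * a\<^sup>2 = (a * cnj a)\<^sup>2" by (simp add: power_mult_distrib)
      also have "a * cnj a = of_real \<beta>" unfolding \<beta>_def by (rule complex_norm_square[symmetric])
      finally show ?thesis by (simp only: of_real_power)
    qed
    then show ?thesis by (simp add: s algebra_simps)
  qed
  then have d: "cmod (1 - cnj (a\<^sup>2) * v) = 1 + s * \<beta>\<^sup>2"
    using s by (simp only: norm_of_real) simp
  have pos: "1 + s * \<beta>\<^sup>2 > 0" using s by (simp add: add_pos_nonneg)
  have "s * \<beta>\<^sup>2 \<le> s * 1" using s \<beta> by (intro mult_left_mono) auto
  then have "\<beta> * (1 + s * \<beta>\<^sup>2) \<le> \<beta> * (1 + s)" using \<beta> by (intro mult_left_mono) auto
  then have "\<beta> \<le> cmod (disc_involution (a\<^sup>2) v)"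
    unfolding disc_involution_def norm_divide n d using pos by (simp add: field_simps)
  with assms le show False by (simp add: \<beta>_def)
qed

text \<open>On the line through 0 perpendicular to \<open>a\<close> the quotient
  \<open>z / a\<close> is imaginary, so its square falls on the slit. This line therefore separates
  the two halves of \<open>X\<close>.\<close>

lemma two_zero_sublevel_off_axis:
  assumes "z \<in> X" shows "Re (z * cnj a) \<noteq> 0"
proof
  assume *: "Re (z * cnj a) = 0"
  have "Re (z / a) = 0"
    unfolding complex_div_cnj[of z a] using * by (simp del: complex_cnj_cnj)
  then have "z\<^sup>2 / a\<^sup>2 \<in> \<real>\<^sub>\<le>\<^sub>0"
    using imaginary_square_nonpos[of "z / a"] by (simp only: power_divide)
  moreover have "z\<^sup>2 \<in> D" using assms by (simp only: mem_two_zero_sublevel_iff)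
  ultimately show False using disc_avoids_opposite_ray by blast
qed

text \<open>This half is the image of the convex set \<open>D\<close> under the branch
  \<open>a * csqrt (v / a\<^sup>2)\<close> of the square root, continuous because \<open>D\<close>
  avoids the cut.\<close>

lemma path_connected_two_zero_sublevel_right: "path_connected (X \<inter> {z. Re (z * cnj a) > 0})"
proof -
  have "path_connected ((\<lambda>v. a * csqrt (v / a\<^sup>2)) ` D)"
    by (intro path_connected_continuous_image convex_imp_path_connected[OF convex_disc] continuous_on_mult
        continuous_on_const continuous_on_compose2[OF continuous_on_csqrt] continuous_on_divide continuous_on_id)
      (use disc_avoids_opposite_ray zero_nonzero in \<open>auto\<close>)
  also have "(\<lambda>v. a * csqrt (v / a\<^sup>2)) ` D = X \<inter> {z. Re (z * cnj a) > 0}"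
  proof (intro equalityI subsetI)
    fix z assume "z \<in> (\<lambda>v. a * csqrt (v / a\<^sup>2)) ` D"
    then obtain v where v: "v \<in> D" "z = a * csqrt (v / a\<^sup>2)" by blast
    have "z\<^sup>2 = v" using zero_nonzero by (simp add: v power_mult_distrib)
    then have "z \<in> X" using v(1) by (simp only: mem_two_zero_sublevel_iff)
    moreover have "Re (csqrt (v / a\<^sup>2)) > 0"
    \<comment> \<open>The principal root has nonnegative real part; real part zero would place
      \<open>v / a\<^sup>2\<close> on the cut.\<close>
    proof (rule ccontr)
      assume "\<not> ?thesis"
      then have "Re (csqrt (v / a\<^sup>2)) = 0" using csqrt_principal[of "v / a\<^sup>2"] by linarith
      then have "v / a\<^sup>2 \<in> \<real>\<^sub>\<le>\<^sub>0"
        using imaginary_square_nonpos[of "csqrt (v / a\<^sup>2)"] by (simp only: power2_csqrt)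
      then show False using disc_avoids_opposite_ray[OF v(1)] by blast
    qed
    moreover have "z * cnj a = of_real ((cmod a)\<^sup>2) * csqrt (v / a\<^sup>2)"
      unfolding v(2) complex_norm_square by (simp only: mult_ac)
    then have "Re (z * cnj a) = (cmod a)\<^sup>2 * Re (csqrt (v / a\<^sup>2))"
      by (simp only: times_complex.sel Re_complex_of_real Im_complex_of_real)
    moreover have "0 < (cmod a)\<^sup>2" using zero_nonzero by simp
    ultimately show "z \<in> X \<inter> {z. Re (z * cnj a) > 0}"
      by (simp only: Int_iff mem_Collect_eq mult_pos_pos)
  next
    fix z assume z: "z \<in> X \<inter> {z. Re (z * cnj a) > 0}"
    have "z / a = (z * cnj a) / of_real ((cmod a)\<^sup>2)"
      by (subst complex_div_cnj) simp
    then have "Re (z / a) > 0"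
      using z zero_nonzero by (simp only: Re_divide_of_real) simp
    then have "csqrt ((z / a)\<^sup>2) = z / a"
      by (intro csqrt_square) auto
    then have "z = a * csqrt (z\<^sup>2 / a\<^sup>2)"
      using zero_nonzero by (simp add: power_divide)
    moreover have "z\<^sup>2 \<in> D" using z by (simp only: mem_two_zero_sublevel_iff Int_iff)
    ultimately show "z \<in> (\<lambda>v. a * csqrt (v / a\<^sup>2)) ` D" by (rule image_eqI)
  qed
  finally show ?thesis .
qed

private lemma two_zero_sublevel_minus: "z \<in> X \<longleftrightarrow> - z \<in> X"
  by (simp only: mem_two_zero_sublevel_iff power2_minus)

text \<open>The reflection \<open>z \<mapsto> - z\<close> preserves \<open>X\<close> and exchanges
  its halves.\<close>

lemma path_connected_two_zero_sublevel_left: "path_connected (X \<inter> {z. Re (z * cnj a) < 0})"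
proof -
  have "X \<inter> {z. Re (z * cnj a) < 0} = uminus ` (X \<inter> {z. Re (z * cnj a) > 0})"
  proof (intro equalityI subsetI)
    fix z assume "z \<in> X \<inter> {z. Re (z * cnj a) < 0}"
    then have "- z \<in> X \<inter> {z. Re (z * cnj a) > 0}" using two_zero_sublevel_minus[of z] by (simp only: Int_iff) simp
    then show "z \<in> uminus ` (X \<inter> {z. Re (z * cnj a) > 0})" by (intro image_eqI[of _ _ "- z"]) simp
  next
    fix z assume "z \<in> uminus ` (X \<inter> {z. Re (z * cnj a) > 0})"
    then obtain y where "z = - y" "y \<in> X \<inter> {z. Re (z * cnj a) > 0}" by blast
    then show "z \<in> X \<inter> {z. Re (z * cnj a) < 0}" using two_zero_sublevel_minus[of y] by (simp only: Int_iff) simp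
  qed
  then show ?thesis
    using path_connected_two_zero_sublevel_right by (simp add: path_connected_continuous_image continuous_on_minus)
qed

end

end

section \<open>Levels, and reduction of arbitrary zeros to opposite ones\<close>

lemma theta_less_1: "theta t < 1"
  by (simp add: theta_def add_pos_pos)

lemma theta_pos: "0 < t \<Longrightarrow> 0 < theta t"
  by (simp add: theta_def add_pos_pos)

lemma theta_strict_mono: "s < t \<Longrightarrow> theta s < theta t"
  by (simp add: theta_def add_pos_pos divide_simps) (simp add: algebra_simps)

text \<open>As \<open>theta t\<close> is \<open>tanh (t / 2)\<close>, this converts the level at
  which the two components merge into the bar length.\<close>

lemma theta_ln:
  assumes "0 < k" shows "theta (ln (1 / k)) = (1 - k) / (1 + k)"
  using assms by (simp add: theta_def divide_simps add_pos_pos)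

lemma two_zero_blaschke_isomorphic_two_bar:
  assumes \<beta>: "cmod \<beta>0 < 1" "cmod \<beta>1 < 1"
    and B: "blaschke_product [\<beta>0, \<beta>1] B"
    and w: "w = (\<beta>0 - \<beta>1) / (1 - cnj \<beta>0 * \<beta>1)"
  shows "pm_isomorphic (induced_pmodule B :: ('f::field, (complex, 'f) fchain set) pmodule)
           (two_bar_module (ln (1 / sqrt (1 - (cmod w)\<^sup>2))))"
proof -
  define w' where "w' = disc_involution \<beta>1 \<beta>0"
  have w'1: "cmod w' < 1"
    unfolding w'_def using \<beta> by (intro cmod_disc_involution_less_1)
  have "1 - cnj \<beta>1 * \<beta>0 = cnj (1 - cnj \<beta>0 * \<beta>1)" by simp
  then have ww': "cmod w = cmod w'"
    unfolding w w'_def disc_involution_def norm_divide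
    by (simp only: complex_mod_cnj norm_minus_commute)
  define k where "k = sqrt (1 - (cmod w)\<^sup>2)"
  have "(cmod w')\<^sup>2 < 1" using w'1 by (simp add: abs_square_less_1)
  then have k: "0 < k" "(cmod w')\<^sup>2 = (1 - k) * (1 + k)"
    by (simp_all add: k_def ww' algebra_simps)
  \<comment> \<open>The hyperbolic midpoint of 0 and \<open>w'\<close>: it solves
    \<open>2 * \<mu> / (1 + (cmod \<mu>)\<^sup>2) = w'\<close>.\<close>
  define \<mu> where "\<mu> = w' / of_real (1 + k)"
  have w'_eq: "w' = \<mu> * of_real (1 + k)" 
    using k(1) by (simp add: \<mu>_def del: of_real_add)
  have \<mu>sq: "(cmod \<mu>)\<^sup>2 = (1 - k) / (1 + k)"
  proof -
    have "(cmod \<mu>)\<^sup>2 = (1 - k) * (1 + k) / (1 + k)\<^sup>2"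
      unfolding \<mu>_def norm_divide power_divide norm_of_real k(2) by simp
    then show ?thesis using k(1) by (simp add: power2_eq_square)
  qed
  moreover have "(1 - k) / (1 + k) < 1" using k(1) by (simp add: divide_simps)
  ultimately have "(cmod \<mu>)\<^sup>2 < 1" by simp
  then have \<mu>: "cmod \<mu> < 1" by (simp add: abs_square_less_1)
  define T where "T = ln (1 / k)"
  have theta_T: "theta T = (cmod \<mu>)\<^sup>2" using theta_ln[OF k(1)] \<mu>sq by (simp add: T_def)
  \<comment> \<open>The first involution sends \<open>\<beta>1\<close> to 0 and
    \<open>\<beta>0\<close> to \<open>w'\<close>; the second sends these to \<open>\<mu>\<close> and
    \<open>- \<mu>\<close>. Reversing the order of the two involutions gives the inverse
    \<open>g\<close>.\<close>
  define h where "h z = disc_involution \<mu> (disc_involution \<beta>1 z)" for z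
  define g where "g z = disc_involution \<beta>1 (disc_involution \<mu> z)" for z
  have h1: "cmod (h z) < 1" and g1: "cmod (g z) < 1" if "cmod z < 1" for z
    unfolding h_def g_def using \<beta> \<mu> that by (simp_all add: cmod_disc_involution_less_1)
  have gh: "g (h z) = z" and hg: "h (g z) = z" if "cmod z < 1" for z
    unfolding h_def g_def using \<beta> \<mu> that
    by (simp_all add: disc_involution_idem cmod_disc_involution_less_1)
  have cont: "continuous_on (ball 0 1) h" "continuous_on (ball 0 1) g"
    unfolding h_def g_def using \<beta> \<mu>
    by (auto intro!: continuous_on_disc_involution continuous_on_id cmod_disc_involution_less_1)
  have "h \<beta>1 = \<mu>" by (simp add: h_def disc_involution_def)
  moreover have "h \<beta>0 = - \<mu>"
  proof -
    have "cnj \<mu> * w' = of_real (1 - k)"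
    proof -
      have "cnj \<mu> * w' = of_real ((cmod \<mu>)\<^sup>2) * of_real (1 + k)"
        unfolding w'_eq complex_norm_square by (simp only: mult_ac)
      also have "\<dots> = of_real ((cmod \<mu>)\<^sup>2 * (1 + k))" by (simp only: of_real_mult)
      also have "(cmod \<mu>)\<^sup>2 * (1 + k) = 1 - k" using k(1) by (simp add: \<mu>sq)
      finally show ?thesis .
    qed
    then have "1 - cnj \<mu> * w' = of_real k" by simp
    moreover have "\<mu> - w' = - \<mu> * of_real k" by (simp add: w'_eq algebra_simps)
    ultimately show ?thesis
      using k(1) by (simp add: h_def disc_involution_def[of \<mu>] flip: w'_def)
  qed
  ultimately have B_eq: "cmod (B z) = cmod (disc_involution \<mu> (h z)) * cmod (disc_involution (- \<mu>) (h z))"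
    if "cmod z < 1" for z
  proof -
    \<comment> \<open>Invariance is used twice, once for each involution in
      \<open>h\<close>.\<close>
    have inv: "cmod (disc_involution (h \<beta>) (h z)) = cmod (disc_involution \<beta> z)" if "cmod \<beta> < 1" for \<beta>
      unfolding h_def using \<beta> \<mu> \<open>cmod z < 1\<close> that
      by (simp add: cmod_disc_involution_invariant cmod_disc_involution_less_1)
    obtain c where c: "cmod c = 1" "B z = c * (disc_involution \<beta>0 z * disc_involution \<beta>1 z)"
      using B \<open>cmod z < 1\<close> unfolding blaschke_product_def disc_involution_def by auto
    have "cmod (B z) = cmod (disc_involution \<beta>1 z) * cmod (disc_involution \<beta>0 z)"
      by (simp add: c norm_mult)
    then show ?thesis
      using inv[OF \<beta>(1)] inv[OF \<beta>(2)] \<open>h \<beta>1 = \<mu>\<close> \<open>h \<beta>0 = - \<mu>\<close> by simp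
  qed
  define X where "X t = {z \<in> ball 0 1. cmod (disc_involution \<mu> z) * cmod (disc_involution (- \<mu>) z) < theta t}" for t
  have sub: "z \<in> sublevel B t \<longleftrightarrow> cmod z < 1 \<and> h z \<in> X t" for z t
    using h1[of z] by (auto simp: sublevel_def X_def B_eq)
  have sub_image: "{z \<in> sublevel B t. h z \<in> P} = g ` (X t \<inter> P)" for t P
  proof (intro equalityI subsetI)
    fix z assume "z \<in> {z \<in> sublevel B t. h z \<in> P}"
    then show "z \<in> g ` (X t \<inter> P)"
      by (intro image_eqI[of _ _ "h z"]) (auto simp: sub gh)
  next
    fix z assume "z \<in> g ` (X t \<inter> P)"
    then obtain y where y: "z = g y" "y \<in> X t" "y \<in> P" by blast
    then have "cmod y < 1" by (simp add: X_def)
    with y show "z \<in> {z \<in> sublevel B t. h z \<in> P}" by (simp add: sub hg g1)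
  qed
  have pc_image: "path_connected {z \<in> sublevel B t. h z \<in> P}" if "path_connected (X t \<inter> P)" for t P
    unfolding sub_image
    by (rule path_connected_continuous_image[OF continuous_on_subset[OF cont(2)] that]) (auto simp: X_def)
  have \<mu>_in: "\<mu> \<in> X t" "- \<mu> \<in> X t" if "0 < t" for t
    using theta_pos[OF that] \<mu> by (auto simp: X_def disc_involution_def)
  \<comment> \<open>The pullback of the half-plane around \<open>\<mu>\<close>, the same for every
    level. For a double zero \<open>\<mu> = 0\<close> and \<open>T = 0\<close>, so no level has to
    be separated.\<close>
  define C where "C = {z. Re (h z * cnj \<mu>) > 0}"
  have "pm_isomorphic (induced_pmodule B :: ('f, (complex, 'f) fchain set) pmodule) (two_bar_module T)"
  proof (rule induced_pmodule_isomorphic_two_bar[where C = C])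
    fix t assume t: "0 < t" "t \<le> T"
    \<comment> \<open>Equality at \<open>t = T\<close> still belongs to the separated case, because
      sublevel sets are defined by a strict inequality. Hence the bar is closed at
      \<open>T\<close>.\<close>
    have le: "theta t \<le> (cmod \<mu>)\<^sup>2" using theta_mono[OF t(2)] theta_T by simp
    have "\<mu> \<noteq> 0" using le theta_pos[OF t(1)] by auto
    have ne: "Re (h z * cnj \<mu>) \<noteq> 0" if "z \<in> sublevel B t" for z
      using two_zero_sublevel_off_axis[OF \<mu> theta_pos[OF t(1)] theta_less_1 le, of "h z"] that by (simp add: sub X_def)
    have 1: "sublevel B t \<inter> C = {z \<in> sublevel B t. h z \<in> {y. Re (y * cnj \<mu>) > 0}}"
      by (auto simp: C_def)
    have 2: "sublevel B t - C = {z \<in> sublevel B t. h z \<in> {y. Re (y * cnj \<mu>) < 0}}"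
      using ne by (auto simp only: C_def mem_Collect_eq Diff_iff not_less order.order_iff_strict)
    have pc: "path_connected (sublevel B t \<inter> C)" "path_connected (sublevel B t - C)"
      unfolding 1 2 using path_connected_two_zero_sublevel_right[OF \<mu> theta_pos[OF t(1)] theta_less_1 le]
        path_connected_two_zero_sublevel_left[OF \<mu> theta_pos[OF t(1)] theta_less_1 le]
      by (intro pc_image; simp add: X_def)+
    have cont_h: "continuous_on (sublevel B t) h"
      by (rule continuous_on_subset[OF cont(1)]) (auto simp: sublevel_def)
    have op: "open {y. Re (y * cnj \<mu>) > 0}" "open {y. Re (y * cnj \<mu>) < 0}"
      by (intro open_Collect_less continuous_intros)+
    have openin: "openin (top_of_set (sublevel B t)) (sublevel B t \<inter> C)"
      "openin (top_of_set (sublevel B t)) (sublevel B t - C)"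
      unfolding 1 2 using continuous_openin_preimage_gen[OF cont_h op(1)]
        continuous_openin_preimage_gen[OF cont_h op(2)]
      by (simp_all add: vimage_def Collect_conj_eq)
    have "0 < (cmod \<mu>)\<^sup>2" using \<open>\<mu> \<noteq> 0\<close> by simp
    moreover have "\<mu> * cnj \<mu> = of_real ((cmod \<mu>)\<^sup>2)" by (rule complex_norm_square[symmetric])
    ultimately have "0 < Re (\<mu> * cnj \<mu>)" by (simp only: Re_complex_of_real)
    then have "sublevel B t \<inter> C \<noteq> {}" "sublevel B t - C \<noteq> {}"
      unfolding 1 2 sub_image using \<mu>_in[OF t(1)] by auto
    with pc openin show "openin (top_of_set (sublevel B t)) (sublevel B t \<inter> C) \<and>
       openin (top_of_set (sublevel B t)) (sublevel B t - C) \<and>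
       path_connected (sublevel B t \<inter> C) \<and> path_connected (sublevel B t - C) \<and>
       sublevel B t \<inter> C \<noteq> {} \<and> sublevel B t - C \<noteq> {}" by blast
  next
    fix t assume t: "0 < t" "T < t"
    have "(cmod \<mu>)\<^sup>2 < theta t" using theta_strict_mono[OF t(2)] theta_T by simp
    then have "path_connected (X t \<inter> UNIV)"
      using path_connected_two_zero_sublevel[OF \<mu> theta_pos[OF t(1)] theta_less_1] by (simp add: X_def)
    then have "path_connected {z \<in> sublevel B t. h z \<in> UNIV}" by (rule pc_image)
    moreover have "{z \<in> sublevel B t. h z \<in> UNIV} \<noteq> {}"
      unfolding sub_image using \<mu>_in[OF t(1)] by auto
    ultimately show "path_connected (sublevel B t) \<and> sublevel B t \<noteq> {}" by simp
  qed
  then show ?thesis by (simp add: T_def k_def)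
qed

theorem theorem5p1:
  fixes B1 B2 :: "complex \<Rightarrow> complex"
    and \<beta>0 \<beta>1 \<gamma>0 \<gamma>1 w1 w2 :: complex
  assumes "norm \<beta>0 < 1" "norm \<beta>1 < 1" "norm \<gamma>0 < 1" "norm \<gamma>1 < 1"
    and "blaschke_product [\<beta>0, \<beta>1] B1"
    and "blaschke_product [\<gamma>0, \<gamma>1] B2"
    and "w1 = (\<beta>0 - \<beta>1) / (1 - cnj \<beta>0 * \<beta>1)"
    and "w2 = (\<gamma>0 - \<gamma>1) / (1 - cnj \<gamma>0 * \<gamma>1)"
  shows "interleaving_distance
           (induced_pmodule B1 :: ('f::field, (complex, 'f) fchain set) pmodule)
           (induced_pmodule B2 :: ('f, (complex, 'f) fchain set) pmodule) =
         ereal (min (max (1/2 * ln (1 / sqrt (1 - (norm w2)\<^sup>2)))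
                         (1/2 * ln (1 / sqrt (1 - (norm w1)\<^sup>2))))
                    \<bar>ln (sqrt (1 - (norm w1)\<^sup>2) / sqrt (1 - (norm w2)\<^sup>2))\<bar>)"
proof -
  \<comment> \<open>Each \<open>w\<close> is a value of \<open>disc_involution\<close>, so its
    modulus is below 1 and both bar lengths are nonnegative.\<close>
  have pos: "0 < sqrt (1 - (norm w)\<^sup>2)" "sqrt (1 - (norm w)\<^sup>2) \<le> 1"
    if "cmod a < 1" "cmod b < 1" "w = (a - b) / (1 - cnj a * b)" for a b w
    using cmod_disc_involution_less_1[OF that(1,2)] that(3)
    by (simp_all add: disc_involution_def abs_square_less_1)
  define k1 k2 where "k1 = sqrt (1 - (norm w1)\<^sup>2)" and "k2 = sqrt (1 - (norm w2)\<^sup>2)"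
  have k: "0 < k1" "k1 \<le> 1" "0 < k2" "k2 \<le> 1"
    unfolding k1_def k2_def using pos assms(1-4,7,8) by blast+
  have "interleaving_distance
           (induced_pmodule B1 :: ('f::field, (complex, 'f) fchain set) pmodule)
           (induced_pmodule B2 :: ('f, (complex, 'f) fchain set) pmodule) =
        interleaving_distance (two_bar_module (ln (1 / k1)) :: ('f, 'f \<times> 'f) pmodule) (two_bar_module (ln (1 / k2)))"
    unfolding k1_def k2_def
    by (intro interleaving_distance_isomorphic
        two_zero_blaschke_isomorphic_two_bar[OF assms(1,2,5,7)]
        two_zero_blaschke_isomorphic_two_bar[OF assms(3,4,6,8)])
  also have "\<dots> = ereal (min (max (ln (1 / k1) / 2) (ln (1 / k2) / 2)) \<bar>ln (1 / k1) - ln (1 / k2)\<bar>)"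
    using k by (intro interleaving_distance_two_bar) simp_all
  also have "\<bar>ln (1 / k1) - ln (1 / k2)\<bar> = \<bar>ln (k1 / k2)\<bar>"
    using k by (simp add: ln_div abs_minus_commute)
  finally show ?thesis
    unfolding k1_def k2_def by (simp only: max.commute mult_1 times_divide_eq_left)
qed

end
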